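(* Let $G$ be a finite graph (loops and multiple edges allowed) with a fixed orientation, $\mathbb{F}$ a field and $\boldsymbol b\in B(G,\mathbb{F})$. Then: (a) $\chi(\tilde{\mathcal{A}}_{E(G)}^{\boldsymbol b},t)$ is a polynomial of degree $n(G)$ with leading coefficient $1$. (b) $\chi(\tilde{\mathcal{A}}_{E(G)}^{\boldsymbol b},t)=\varphi_{G\setminus E_{\rm cut}^{\boldsymbol b}(G)}(\alpha,t)=\varphi_G(\tilde{\Pi}_{\boldsymbol b},t)$ with $\alpha=\alpha_{G\setminus E_{\rm cut}^{\boldsymbol b}(G),\boldsymbol b}$, where $\tilde{\Pi}_{\boldsymbol b}=\{\pi\in\tilde{\Pi}(G):\boldsymbol b\in B_{\pi}\}$. In particular, $\varphi_G(\tilde{\Pi}_{\boldsymbol 0},t)$ is the flow polynomial $\varphi_{G\setminus E_{\rm cut}(G)}(t)$. (c) If $\mathbb{F}=\mathbb{F}_q$ is a finite field of $q$ elements, then $$\chi(\tilde{\mathcal{A}}_{E(G)}^{\boldsymbol b},q)=|M(\tilde{\mathcal{A}}_{E(G)}^{\boldsymbol b})|=|F_{\rm nz}(G\setminus E^{\boldsymbol b}_{\rm cut}(G),\boldsymbol b;\mathbb{F}_q)|=\varphi_G(\tilde{\Pi}_{\boldsymbol b},q).$$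
   Context: Graph notation. For $S\subseteq E(G)$: $S^c=E(G)\smallsetminus S$; $c(S)$ is the number of components of $(V(G),S)$; $r(S)=|V(G)|-c(S)$; $n(S)=|S|-r(S)$; $c(G)=c(E(G))$, $n(G)=n(E(G))$. $\pi(S)$ is the partition of $V(G)$ into vertex sets of components of $(V(G),S)$; $\Pi(G)=\{\pi(S):S\subseteq E(G)\}$. $E_{\rm cyc}(G)$ is the set of edges contained in at least one cycle (loops included), $E_{\rm cut}(G)=E(G)\smallsetminus E_{\rm cyc}(G)$ is the set of cut-edges. $G\setminus S$ is $G$ with the edges of $S$ deleted (same vertex set, inherited orientation); $G[X]$ is the subgraph induced by $X\subseteq V(G)$. $\tilde\Pi(G)=\{\pi(S)\in\Pi(G):E_{\rm cut}(G)\subseteq S\}$. Flow polynomials. The flow polynomial is $\varphi_G(t)=\sum_{S\subseteq E(G)}(-1)^{|S^c|}t^{n(S)}$; for $\mathfrak{p}\subseteq\Pi(G)$, $\varphi_G(\mathfrak{p},t)=\sum_{S\subseteq E(G),\,\pi(S)\in\mathfrak{p}}(-1)^{|S^c|}t^{n(S)}$. Affine flows. The boundary operator $\partial:\mathbb{F}^{E(G)}\to\mathbb{F}^{V(G)}$ is $\partial\boldsymbol c(v)=\sum_{e\in E^+(v)}\boldsymbol c(e)-\sum_{e\in E^-(v)}\boldsymbol c(e)$, where $E^+(v)$ (resp. $E^-(v)$) is the set of edges with head (resp. tail) $v$ (loops contribute $0$). $B(G,\mathbb{F})=\partial(\mathbb{F}^{E(G)})$. $F(G,\boldsymbol b;\mathbb{F})=\{\boldsymbol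 c\in\mathbb{F}^{E(G)}:\partial\boldsymbol c=\boldsymbol b\}$ and $F_{\rm nz}(G,\boldsymbol b;\mathbb{F})$ is the set of $\boldsymbol c\in F(G,\boldsymbol b;\mathbb{F})$ with $\boldsymbol c(e)\neq0$ for all $e\in E(G)$. For $\pi\in\Pi(G)$, $B_\pi=\{\boldsymbol x\in\mathbb{F}^{V(G)}:\sum_{v\in U}\boldsymbol x(v)=0\text{ for every block }U\in\pi\}$. $E_{\rm cut}^{\boldsymbol b}(G)=\{e\in E_{\rm cut}(G):\boldsymbol b\in B(G\setminus e,\mathbb{F})\}$. Arrangements. For a finite set $\mathcal{A}$ of affine subspaces of an affine space $V$ over $\mathbb{F}$, $\chi(\mathcal{A},t)=\sum_{\mathcal{B}\subseteq\mathcal{A},\,\bigcap_{H\in\mathcal{B}}H\neq\emptyset}(-1)^{|\mathcal{B}|}t^{\dim\bigcap_{H\in\mathcal{B}}H}$ (the empty intersection is $V$), and $M(\mathcal{A})=V\smallsetminus\bigcup_{H\in\mathcal{A}}H$. Let $H_e=\{\boldsymbol x\in\mathbb{F}^{E(G)}:\boldsymbol x(e)=0\}$ and $H_e^{\boldsymbol b}=H_e\cap F(G,\boldsymbol b;\mathbb{F})$. $\mathcal{A}_{E(G)}^{\boldsymbol b}=\{H_e^{\boldsymbol b}:e\in E(G),H_e^{\boldsymbol b}\neq\emptyset\}$, an arrangement in $F(G,\boldsymbol b;\mathbb{F})$ (possibly containing the whole space), and $\tilde{\mathcal{A}}_{E(G)}^{\boldsymbol b}=\mathcal{A}_{E(G)}^{\boldsymbol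 b}\smallsetminus\{F(G,\boldsymbol b;\mathbb{F})\}$, a hyperplane arrangement in $F(G,\boldsymbol b;\mathbb{F})$. Assigning polynomial. For a graph $H$ let $\Lambda(H)$ be the family of nonempty $X\subseteq V(H)$ with $H[X]$ connected and $c(H[V(H)\smallsetminus X])=c(H)$. A function $\boldsymbol b$ on $V(H)$ induces $\alpha_{H,\boldsymbol b}:\Lambda(H)\to\{0,1\}$ with $\alpha_{H,\boldsymbol b}(X)=0$ iff $\sum_{v\in X}\boldsymbol b(v)=0$. For $\boldsymbol b\in B(H,\mathbb{F})$ and $\alpha=\alpha_{H,\boldsymbol b}$, the assigning polynomial is $\varphi_H(\alpha,t)=\sum(-1)^{|S|}t^{n(E(H)\smallsetminus S)}$, summed over all $S\subseteq E(H)$ such that $H\setminus S$ is $\boldsymbol b$-compatible, i.e. $\sum_{v}\boldsymbol b(v)=0$ over the vertices of each component of $H\setminus S$. *)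

theory Defs
  imports
    "Graph_Theory.Digraph_Component"
    "HOL-Library.FuncSet"
    "HOL-Library.Function_Algebras"
    "HOL-Computational_Algebra.Polynomial"
begin

text \<open>
  A finite graph with a fixed orientation, loops and multiple edges allowed, is a
  \<^locale>\<open>fin_digraph\<close>: \<^term>\<open>tail G\<close> and \<^term>\<open>head G\<close> give the orientation. All notions of
  connectivity, components and cycles below refer to the underlying undirected graph.
\<close>

subsection \<open>Graph notions\<close>

definition edge_subgraph :: "('v, 'e) pre_digraph \<Rightarrow> 'e set \<Rightarrow> ('v, 'e) pre_digraph" where
  "edge_subgraph G S = G\<lparr>arcs := S\<rparr>"

definition del_edges :: "('v, 'e) pre_digraph \<Rightarrow> 'e set \<Rightarrow> ('v, 'e) pre_digraph" where
  "del_edges G S = G\<lparr>arcs := arcs G - S\<rparr>"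

text \<open>Vertex sets of the components: the strong components of the symmetric closure
  (compare the library's \<^const>\<open>connected\<close>, which is strong connectedness of that closure).\<close>

definition components :: "('v, 'e) pre_digraph \<Rightarrow> 'v set set" where
  "components G = pre_digraph.sccs_verts (with_proj (mk_symmetric G))"

definition num_components :: "('v, 'e) pre_digraph \<Rightarrow> nat" where
  "num_components G = card (components G)"

definition edge_partition :: "('v, 'e) pre_digraph \<Rightarrow> 'e set \<Rightarrow> 'v set set" where
  "edge_partition G S = components (edge_subgraph G S)"

text \<open>For a finite graph and a set \<open>S\<close> of its edges, neither natural-number subtraction truncates.\<close>

definition edge_rank :: "('v, 'e) pre_digraph \<Rightarrow> 'e set \<Rightarrow> nat" where
  "edge_rank G S = card (verts G) - num_components (edge_subgraph G S)"

definition nullity :: "('v, 'e) pre_digraph \<Rightarrow> 'e set \<Rightarrow> nat" where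
  "nullity G S = card S - edge_rank G S"

text \<open>A cycle \<open>v\<^sub>0 e\<^sub>0 v\<^sub>1 e\<^sub>1 \<dots> v\<^sub>k e\<^sub>k v\<^sub>0\<close> with distinct vertices and distinct edges, where
  \<open>e\<^sub>i\<close> joins \<open>v\<^sub>i\<close> to its cyclic successor in either direction. Length one is a loop, length
  two is a pair of parallel edges.\<close>

definition undirected_cycle :: "('v, 'e) pre_digraph \<Rightarrow> 'v list \<Rightarrow> 'e list \<Rightarrow> bool" where
  "undirected_cycle G vs es \<longleftrightarrow>
     es \<noteq> [] \<and> length vs = length es \<and> distinct vs \<and> distinct es \<and>
     set vs \<subseteq> verts G \<and> set es \<subseteq> arcs G \<and>
     (\<forall>i < length es. {tail G (es ! i), head G (es ! i)} = {vs ! i, vs ! (Suc i mod length es)})"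

definition E_cyc :: "('v, 'e) pre_digraph \<Rightarrow> 'e set" where
  "E_cyc G = {e \<in> arcs G. \<exists>vs es. undirected_cycle G vs es \<and> e \<in> set es}"

definition E_cut :: "('v, 'e) pre_digraph \<Rightarrow> 'e set" where
  "E_cut G = arcs G - E_cyc G"

definition edge_partitions :: "('v, 'e) pre_digraph \<Rightarrow> 'v set set set" where
  "edge_partitions G = {edge_partition G S | S. S \<subseteq> arcs G}"

definition edge_partitions_cut :: "('v, 'e) pre_digraph \<Rightarrow> 'v set set set" where
  "edge_partitions_cut G = {edge_partition G S | S. S \<subseteq> arcs G \<and> E_cut G \<subseteq> S}"

subsection \<open>Flow polynomials\<close>

definition flow_poly :: "('v, 'e) pre_digraph \<Rightarrow> int poly" where
  "flow_poly G = (\<Sum>S \<in> Pow (arcs G). monom ((-1) ^ card (arcs G - S)) (nullity G S))"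

definition flow_poly_on :: "('v, 'e) pre_digraph \<Rightarrow> 'v set set set \<Rightarrow> int poly" where
  "flow_poly_on G \<pp> = (\<Sum>S \<in> {S. S \<subseteq> arcs G \<and> edge_partition G S \<in> \<pp>}.
     monom ((-1) ^ card (arcs G - S)) (nullity G S))"

subsection \<open>Affine flows\<close>

text \<open>Vectors indexed by a set \<open>I\<close> are total functions vanishing outside \<open>I\<close>. In this way the
  coordinate space is a subspace of the function type, and the coordinate space of a subset
  of \<open>I\<close> is a subspace of the coordinate space of \<open>I\<close>.\<close>

definition coord_space :: "'i set \<Rightarrow> ('i \<Rightarrow> 'f::field) set" where
  "coord_space I = {x. \<forall>i. i \<notin> I \<longrightarrow> x i = 0}"

definition boundary :: "('v, 'e) pre_digraph \<Rightarrow> ('e \<Rightarrow> 'f::field) \<Rightarrow> 'v \<Rightarrow> 'f" where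
  "boundary G c v = (\<Sum>e \<in> in_arcs G v. c e) - (\<Sum>e \<in> out_arcs G v. c e)"

definition boundary_space :: "('v, 'e) pre_digraph \<Rightarrow> ('v \<Rightarrow> 'f::field) set" where
  "boundary_space G = boundary G ` coord_space (arcs G)"

definition flows :: "('v, 'e) pre_digraph \<Rightarrow> ('v \<Rightarrow> 'f::field) \<Rightarrow> ('e \<Rightarrow> 'f) set" where
  "flows G b = {c \<in> coord_space (arcs G). boundary G c = b}"

definition nz_flows :: "('v, 'e) pre_digraph \<Rightarrow> ('v \<Rightarrow> 'f::field) \<Rightarrow> ('e \<Rightarrow> 'f) set" where
  "nz_flows G b = {c \<in> flows G b. \<forall>e \<in> arcs G. c e \<noteq> 0}"

definition partition_space :: "('v, 'e) pre_digraph \<Rightarrow> 'v set set \<Rightarrow> ('v \<Rightarrow> 'f::field) set" where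
  "partition_space G \<pi> = {x \<in> coord_space (verts G). \<forall>U \<in> \<pi>. (\<Sum>v \<in> U. x v) = 0}"

definition E_cut_b :: "('v, 'e) pre_digraph \<Rightarrow> ('v \<Rightarrow> 'f::field) \<Rightarrow> 'e set" where
  "E_cut_b G b = {e \<in> E_cut G. b \<in> boundary_space (del_edges G {e})}"

definition edge_partitions_b ::
    "('v, 'e) pre_digraph \<Rightarrow> ('v \<Rightarrow> 'f::field) \<Rightarrow> 'v set set set" where
  "edge_partitions_b G b = {\<pi> \<in> edge_partitions_cut G. b \<in> partition_space G \<pi>}"

subsection \<open>Arrangements of affine subspaces\<close>

definition fun_scale :: "'f::field \<Rightarrow> ('i \<Rightarrow> 'f) \<Rightarrow> 'i \<Rightarrow> 'f" where
  "fun_scale a x = (\<lambda>i. a * x i)"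

lemma vector_space_fun_scale: "vector_space fun_scale"
  by unfold_locales (auto simp: fun_scale_def fun_eq_iff algebra_simps)

text \<open>The dimension of a nonempty affine subspace is the dimension of its direction, the linear
  subspace of all differences of its points.\<close>

definition affine_dim :: "('i \<Rightarrow> 'f::field) set \<Rightarrow> nat" where
  "affine_dim A = vector_space.dim fun_scale {x - y | x y. x \<in> A \<and> y \<in> A}"

text \<open>The ambient space \<open>V\<close> is an argument; it makes the empty intersection equal to \<open>V\<close>.\<close>

definition char_poly_arr ::
    "('i \<Rightarrow> 'f::field) set \<Rightarrow> ('i \<Rightarrow> 'f) set set \<Rightarrow> int poly" where
  "char_poly_arr V \<A> = (\<Sum>\<B> \<in> {\<B>. \<B> \<subseteq> \<A> \<and> V \<inter> \<Inter>\<B> \<noteq> {}}.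
     monom ((-1) ^ card \<B>) (affine_dim (V \<inter> \<Inter>\<B>)))"

definition arr_complement ::
    "('i \<Rightarrow> 'f::field) set \<Rightarrow> ('i \<Rightarrow> 'f) set set \<Rightarrow> ('i \<Rightarrow> 'f) set" where
  "arr_complement V \<A> = V - \<Union>\<A>"

definition coord_hyperplane :: "('v, 'e) pre_digraph \<Rightarrow> 'e \<Rightarrow> ('e \<Rightarrow> 'f::field) set" where
  "coord_hyperplane G e = {x \<in> coord_space (arcs G). x e = 0}"

definition flow_hyperplane ::
    "('v, 'e) pre_digraph \<Rightarrow> ('v \<Rightarrow> 'f::field) \<Rightarrow> 'e \<Rightarrow> ('e \<Rightarrow> 'f) set" where
  "flow_hyperplane G b e = coord_hyperplane G e \<inter> flows G b"

definition flow_arr ::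
    "('v, 'e) pre_digraph \<Rightarrow> ('v \<Rightarrow> 'f::field) \<Rightarrow> ('e \<Rightarrow> 'f) set set" where
  "flow_arr G b = {flow_hyperplane G b e | e. e \<in> arcs G \<and> flow_hyperplane G b e \<noteq> {}}"

definition flow_arr_proper ::
    "('v, 'e) pre_digraph \<Rightarrow> ('v \<Rightarrow> 'f::field) \<Rightarrow> ('e \<Rightarrow> 'f) set set" where
  "flow_arr_proper G b = flow_arr G b - {flows G b}"

subsection \<open>The assigning polynomial\<close>

definition Lambda :: "('v, 'e) pre_digraph \<Rightarrow> 'v set set" where
  "Lambda H = {X. X \<noteq> {} \<and> X \<subseteq> verts H \<and> connected (H \<restriction> X) \<and>
     num_components (H \<restriction> (verts H - X)) = num_components H}"

definition assigning :: "('v, 'e) pre_digraph \<Rightarrow> ('v \<Rightarrow> 'f::field) \<Rightarrow> 'v set \<Rightarrow> nat" where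
  "assigning H b = (\<lambda>X \<in> Lambda H. if (\<Sum>v \<in> X. b v) = 0 then 0 else 1)"

definition b_compatible :: "('v \<Rightarrow> 'f::field) \<Rightarrow> ('v, 'e) pre_digraph \<Rightarrow> bool" where
  "b_compatible b K \<longleftrightarrow> (\<forall>U \<in> components K. (\<Sum>v \<in> U. b v) = 0)"

text \<open>The assigning polynomial is a function of \<open>\<alpha>\<close>. It is defined through a representative, that
  is, a boundary \<open>b\<close> over the field \<open>'f\<close> that induces \<open>\<alpha>\<close>. The type argument names the field, which
  \<open>\<alpha>\<close> does not mention. If \<open>b\<close> and \<open>b'\<close> in \<open>B(H)\<close> induce the same \<open>\<alpha>\<close>, the same edge sets are compatible:
  if \<open>U\<close> is a component of \<open>H\<close> minus \<open>S\<close> inside the component \<open>C\<close> of \<open>H\<close>, then the components of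
  \<open>H[C - U]\<close> belong to \<^const>\<open>Lambda\<close>, and each is a union of components of \<open>H\<close> minus \<open>S\<close>.\<close>

definition assigning_poly ::
    "'f::field itself \<Rightarrow> ('v, 'e) pre_digraph \<Rightarrow> ('v set \<Rightarrow> nat) \<Rightarrow> int poly" where
  "assigning_poly _ H \<alpha> =
     (let b = (SOME b :: 'v \<Rightarrow> 'f. b \<in> boundary_space H \<and> assigning H b = \<alpha>)
      in \<Sum>S \<in> {S. S \<subseteq> arcs H \<and> b_compatible b (del_edges H S)}.
           monom ((-1) ^ card S) (nullity H (arcs H - S)))"

end

theory Submission
  imports Defs
begin

text \<open>The polynomials of the theorem all equal \<open>flow_sum b\<close>, the sum of \<open>(-1)^|E - T| t^n(T)\<close> over the edge
sets \<open>T\<close> that contain all cut-edges and carry a flow with boundary \<open>b\<close>. For \<open>\<phi>\<^sub>G\<close> this is because the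
partition \<open>\<pi>(T)\<close> determines both properties of \<open>T\<close>; for \<open>b = 0\<close> every \<open>T\<close> carries a flow, and removing
the cut-edges from all \<open>T\<close> yields the flow polynomial of the graph without cut-edges.

Two facts about a single edge set \<open>T\<close> drive everything. The circulations supported on \<open>T\<close> form a space of
dimension \<open>n(T)\<close> (\<open>circulation_basis\<close>): when an edge is added, the nullity and the dimension both grow
by one if its ends are already connected, because the edge then closes a cycle, and both stay the same
otherwise, because an edge whose ends are not connected without it carries no circulation. And \<open>b\<close> is a
boundary of a vector supported on \<open>T\<close> iff it sums to zero over each component of \<open>(V, T)\<close>
(\<open>boundary_space_iff\<close>): each \<open>b\<close> of this kind is a combination of boundaries of paths to chosen
representatives of the components.

For the characteristic polynomial, the intersection of the hyperplanes of the edges in \<open>S\<close> is the space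
of flows on \<open>E - S\<close>, an affine space of dimension \<open>n(E - S)\<close>. Several edges may give the same hyperplane,
but the signed sum over sets of hyperplanes equals the signed sum over sets of edges
(\<open>alternating_sum_image\<close>). Edges with an empty hyperplane contribute nothing. The hyperplane of \<open>e\<close> is the
whole flow space exactly for \<open>e \<in> E_cut_b G b\<close> (\<open>flow_hyperplane_eq_flows_iff\<close>): an edge on a cycle carries a
circulation that changes its value, while all flows agree on a cut-edge. Hence \<open>S\<close> may range over the
subsets of \<open>E - E_cut_b G b\<close>, and complementation gives \<open>flow_sum b\<close>, since an edge set that carries a
flow with boundary \<open>b\<close> contains all cut-edges as soon as it contains those in \<open>E_cut_b G b\<close>.

The set of all edges contributes the leading term, because the omission of an edge on a cycle lowers the
nullity. Over a field with \<open>q\<close> elements a nonempty flow space on \<open>T\<close> has \<open>q^n(T)\<close> elements, so evaluation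
at \<open>q\<close> turns the characteristic polynomial into an inclusion-exclusion count of the complement.

The assigning polynomial is defined through an arbitrary boundary with the given assigning, so that
compatibility has to be recovered from the assigning alone (\<open>b_compatible_cong\<close>). The sum of \<open>b\<close> over a
component \<open>U\<close> of a spanning subgraph, lying in the component \<open>C\<close> of the graph, is minus the sum over the
components of the subgraph induced by \<open>C - U\<close>, and each of these belongs to \<open>\<Lambda>\<close>.\<close>

section \<open>Connectivity of the underlying undirected graph\<close>

definition ends_rel :: "('v, 'e) pre_digraph \<Rightarrow> 'v rel" where
  "ends_rel K = (\<Union>e\<in>arcs K. {(tail K e, head K e), (head K e, tail K e)})"

text \<open>Reachability in the underlying undirected graph, in the form of a closure operator with an induction
rule; on the vertex set it is the equivalence relation whose classes are the components.\<close>

definition link :: "('v, 'e) pre_digraph \<Rightarrow> 'v rel" where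
  "link K = rtrancl_on (verts K) (ends_rel K)"

lemma reachable_mk_symmetric: "u \<rightarrow>\<^sup>*\<^bsub>with_proj (mk_symmetric K)\<^esub> v \<longleftrightarrow> (u, v) \<in> link K"
proof -
  have "arcs_ends (with_proj (mk_symmetric K)) = ends_rel K"
    by (auto simp: arcs_ends_conv mk_symmetric_def ends_rel_def)
  then show ?thesis by (simp add: reachable_def link_def)
qed

lemma sym_ends_rel: "sym (ends_rel K)"
  by (auto simp: sym_def ends_rel_def)

lemma link_sym: "(x, y) \<in> link K \<Longrightarrow> (y, x) \<in> link K"
  unfolding link_def using rtrancl_on_converseI[of x y] sym_ends_rel[of K]
  by (metis sym_conv_converse_eq)

lemma link_trans: "(x, y) \<in> link K \<Longrightarrow> (y, z) \<in> link K \<Longrightarrow> (x, z) \<in> link K"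
  unfolding link_def by (rule rtrancl_on_trans)

lemma link_refl: "x \<in> verts K \<Longrightarrow> (x, x) \<in> link K"
  by (simp add: link_def)

lemma link_verts: "(x, y) \<in> link K \<Longrightarrow> x \<in> verts K \<and> y \<in> verts K"
  unfolding link_def by (blast dest: in_rtrancl_on_in_F)

lemma equiv_link: "equiv (verts K) (link K)"
  by (rule equivI) (auto simp: refl_on_def sym_def trans_def dest: link_verts
      intro: link_refl link_sym link_trans)

lemma link_arc:
  assumes "wf_digraph K" "e \<in> arcs K"
  shows "(tail K e, head K e) \<in> link K"
proof -
  have "tail K e \<in> verts K" "head K e \<in> verts K"
    using assms by (auto simp: wf_digraph_def)
  moreover have "(tail K e, head K e) \<in> ends_rel K"
    using assms by (auto simp: ends_rel_def)
  ultimately show ?thesis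
    unfolding link_def by (blast intro: rtrancl_on.intros)
qed

lemma components_eq_quotient: "components K = verts K // link K"
proof (intro set_eqI iffI)
  fix C assume "C \<in> components K"
  then have C: "C \<noteq> {}" "\<And>u v. u \<in> C \<Longrightarrow> v \<in> C \<Longrightarrow> (u, v) \<in> link K"
    "\<And>u v. u \<in> C \<Longrightarrow> v \<notin> C \<Longrightarrow> (u, v) \<notin> link K"
    by (auto simp: components_def pre_digraph.sccs_verts_def reachable_mk_symmetric dest: link_sym)
  then obtain u where u: "u \<in> C" by blast
  then have "C = link K `` {u}" using C by blast
  moreover have "u \<in> verts K" using u C(2) link_verts by metis
  ultimately show "C \<in> verts K // link K" by (simp add: quotientI)
next
  fix C assume "C \<in> verts K // link K"
  then obtain u where "u \<in> verts K" "C = link K `` {u}" by (rule quotientE)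
  then show "C \<in> components K"
    by (auto simp: components_def pre_digraph.sccs_verts_def reachable_mk_symmetric
        intro: link_refl link_trans link_sym)
qed

lemma link_closed:
  assumes "(x, y) \<in> link K" "x \<in> U" "\<And>e. e \<in> arcs K \<Longrightarrow> tail K e \<in> U \<longleftrightarrow> head K e \<in> U"
  shows "y \<in> U"
  using assms(1)[unfolded link_def]
proof (induct rule: rtrancl_on_induct)
  case base then show ?case using assms(2) by simp
next
  case (step y z) then show ?case using assms(3) by (auto simp: ends_rel_def)
qed

lemma connected_iff_link:
  "connected K \<longleftrightarrow> verts K \<noteq> {} \<and> (\<forall>u\<in>verts K. \<forall>v\<in>verts K. (u, v) \<in> link K)"
  unfolding connected_def strongly_connected_def reachable_mk_symmetric by simp

text \<open>Recognizes a partition as the set of components: blocks that are internally connected cannot be too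
large, and blocks that no edge leaves cannot be too small. The effect of a change of the graph on its
components is always read off from this.\<close>

lemma components_eqI:
  assumes "\<Union>P = verts K" "{} \<notin> P"
    and linked: "\<And>A x y. A \<in> P \<Longrightarrow> x \<in> A \<Longrightarrow> y \<in> A \<Longrightarrow> (x, y) \<in> link K"
    and closed: "\<And>A e. A \<in> P \<Longrightarrow> e \<in> arcs K \<Longrightarrow> tail K e \<in> A \<longleftrightarrow> head K e \<in> A"
  shows "components K = P"
proof -
  have cls: "link K `` {x} = A" if "A \<in> P" "x \<in> A" for A x
    using that linked link_closed[of x _ K A] closed by blast
  show ?thesis
  proof (intro set_eqI iffI)
    fix C assume "C \<in> components K"
    then obtain x where "x \<in> verts K" "C = link K `` {x}"
      unfolding components_eq_quotient by (auto elim: quotientE)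
    then show "C \<in> P" using cls assms(1) by (metis UnionE)
  next
    fix C assume C: "C \<in> P"
    then obtain x where x: "x \<in> C" using assms(2) by (metis all_not_in_conv)
    then have "x \<in> verts K" using C assms(1) by blast
    then show "C \<in> components K"
      unfolding components_eq_quotient using cls[OF C x] by (metis quotientI)
  qed
qed

lemma component_closed:
  assumes "wf_digraph K" "C \<in> components K" "e \<in> arcs K"
  shows "tail K e \<in> C \<longleftrightarrow> head K e \<in> C"
  using assms(2) link_arc[OF assms(1,3)] unfolding components_eq_quotient
  by (auto elim!: quotientE dest: link_sym link_trans)

lemma component_linked: "C \<in> components K \<Longrightarrow> x \<in> C \<Longrightarrow> y \<in> C \<Longrightarrow> (x, y) \<in> link K"
  unfolding components_eq_quotient by (auto elim!: quotientE intro: link_sym link_trans)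

lemma Union_components: "\<Union>(components K) = verts K"
  unfolding components_eq_quotient by (rule Union_quotient[OF equiv_link])

lemma components_nonempty: "C \<in> components K \<Longrightarrow> C \<noteq> {}"
  unfolding components_eq_quotient by (rule in_quotient_imp_non_empty[OF equiv_link])

lemma components_disjoint:
  "C \<in> components K \<Longrightarrow> D \<in> components K \<Longrightarrow> C \<noteq> D \<Longrightarrow> C \<inter> D = {}"
  unfolding components_eq_quotient using quotient_disj[OF equiv_link] by blast

lemma finite_components: "finite (verts K) \<Longrightarrow> finite (components K)"
  by (metis Union_components finite_UnionD)

lemma num_components_le: "finite (verts K) \<Longrightarrow> num_components K \<le> card (verts K)"
  unfolding num_components_def components_eq_quotient quotient_def
  by (rule order_trans[OF card_UN_le]) auto

text \<open>A partition remembers its equivalence relation. This is what lets a cut-edge that is forced into one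
edge set be found in every other edge set with the same partition.\<close>

lemma link_eq_if_components_eq:
  fixes K L :: "('v, 'e) pre_digraph"
  assumes "components K = components L" shows "link K = link L"
proof -
  have "link K \<subseteq> link L" if "components K = components L" for K L :: "('v, 'e) pre_digraph"
  proof (clarify)
    fix x y assume xy: "(x, y) \<in> link K"
    then have "link K `` {x} \<in> components L"
      using that link_verts unfolding components_eq_quotient by (metis quotientI)
    then show "(x, y) \<in> link L"
      using component_linked[of _ L x y] xy link_refl link_verts
      by (metis Image_singleton_iff)
  qed
  then show ?thesis using assms by (metis subset_antisym)
qed

section \<open>Components and nullity when an edge is added\<close>

lemma edge_subgraph_simps [simp]:
  "verts (edge_subgraph G S) = verts G" "arcs (edge_subgraph G S) = S"
  "tail (edge_subgraph G S) = tail G" "head (edge_subgraph G S) = head G"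
  "edge_subgraph (edge_subgraph G S) T = edge_subgraph G T"
  by (simp_all add: edge_subgraph_def)

lemma edge_subgraph_arcs [simp]: "edge_subgraph G (arcs G) = G"
  by (simp add: edge_subgraph_def)

lemma del_edges_eq_edge_subgraph: "del_edges G S = edge_subgraph G (arcs G - S)"
  by (simp add: del_edges_def edge_subgraph_def)

lemma link_mono:
  assumes "(x, y) \<in> link K" "verts K \<subseteq> verts L" "arcs K \<subseteq> arcs L"
    "tail K = tail L" "head K = head L"
  shows "(x, y) \<in> link L"
  using assms(1)[unfolded link_def]
proof (induct rule: rtrancl_on_induct)
  case base then show ?case using assms(2) by (auto intro: link_refl)
next
  case (step y z)
  then have "(y, z) \<in> ends_rel L" "z \<in> verts L" using assms by (auto simp: ends_rel_def)
  then show ?case using step unfolding link_def by (metis rtrancl_on_into_rtrancl_on)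
qed

context fin_digraph
begin

lemma wf_edge_subgraph: "S \<subseteq> arcs G \<Longrightarrow> wf_digraph (edge_subgraph G S)"
  by (auto simp: wf_digraph_def)

lemma fin_edge_subgraph: "S \<subseteq> arcs G \<Longrightarrow> fin_digraph (edge_subgraph G S)"
  by (auto simp: fin_digraph_def fin_digraph_axioms_def wf_edge_subgraph intro: finite_subset)

lemma link_subset_mono:
  "(x, y) \<in> link (edge_subgraph G S) \<Longrightarrow> S \<subseteq> T \<Longrightarrow> (x, y) \<in> link (edge_subgraph G T)"
  by (erule link_mono) auto

lemma components_insert_linked:
  assumes "insert e S \<subseteq> arcs G" "(tail G e, head G e) \<in> link (edge_subgraph G S)"
  shows "components (edge_subgraph G (insert e S)) = components (edge_subgraph G S)"
proof (rule components_eqI)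
  let ?K = "edge_subgraph G S"
  show "\<Union>(components ?K) = verts (edge_subgraph G (insert e S))"
    by (simp add: Union_components)
  show "{} \<notin> components ?K" using components_nonempty by blast
  show "(x, y) \<in> link (edge_subgraph G (insert e S))"
    if "C \<in> components ?K" "x \<in> C" "y \<in> C" for C x y
    using component_linked[OF that] by (rule link_subset_mono) auto
  show "tail (edge_subgraph G (insert e S)) f \<in> C \<longleftrightarrow> head (edge_subgraph G (insert e S)) f \<in> C"
    if C: "C \<in> components ?K" and f: "f \<in> arcs (edge_subgraph G (insert e S))" for C f
  proof (cases "f = e")
    case True
    have clo: "\<And>f. f \<in> arcs ?K \<Longrightarrow> tail ?K f \<in> C \<longleftrightarrow> head ?K f \<in> C"
      using component_closed[OF wf_edge_subgraph C] assms(1) by blast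
    have "tail G e \<in> C \<longleftrightarrow> head G e \<in> C"
      using link_closed[OF assms(2) _ clo] link_closed[OF link_sym[OF assms(2)] _ clo] by blast
    then show ?thesis using True by simp
  next
    case False
    then show ?thesis using f component_closed[OF wf_edge_subgraph C] assms by simp
  qed
qed

text \<open>The components of the two ends are merged and all others stay.\<close>

lemma num_components_insert_unlinked:
  assumes ins: "insert e S \<subseteq> arcs G" and nl: "(tail G e, head G e) \<notin> link (edge_subgraph G S)"
  shows "Suc (num_components (edge_subgraph G (insert e S))) = num_components (edge_subgraph G S)"
proof -
  let ?K = "edge_subgraph G S" and ?L = "edge_subgraph G (insert e S)"
  define Q where "Q = components ?K"
  have ends: "tail G e \<in> verts G" "head G e \<in> verts G" using ins by auto
  obtain A B where A: "A \<in> Q" "tail G e \<in> A" and B: "B \<in> Q" "head G e \<in> B"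
    using ends Union_components[of ?K] unfolding Q_def edge_subgraph_simps(1) by blast
  have "A \<noteq> B"
    using nl component_linked[OF A(1)[unfolded Q_def] A(2), of "head G e"] B by auto
  have dis: "C \<inter> D = {}" if "C \<in> Q" "D \<in> Q" "C \<noteq> D" for C D
    using that components_disjoint unfolding Q_def by blast
  have ne: "C \<noteq> {}" if "C \<in> Q" for C using that components_nonempty unfolding Q_def by blast
  have clo: "tail G f \<in> C \<longleftrightarrow> head G f \<in> C" if "C \<in> Q" "f \<in> S" for C f
    using that component_closed[of ?K C f] wf_edge_subgraph ins unfolding Q_def by simp
  have fin: "finite Q" unfolding Q_def by (rule finite_components) simp
  have lk: "(x, y) \<in> link ?L" if "C \<in> Q" "x \<in> C" "y \<in> C" for C x y
    using component_linked[of C ?K x y] that link_subset_mono[of x y S "insert e S"]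
    unfolding Q_def by blast
  have elk: "(tail G e, head G e) \<in> link ?L"
    using link_arc[of ?L e] wf_edge_subgraph[OF ins] by simp
  define P where "P = insert (A \<union> B) (Q - {A, B})"
  have "components ?L = P"
  proof (rule components_eqI)
    have "\<Union>P = \<Union>Q" unfolding P_def using A B by blast
    then show "\<Union>P = verts ?L" unfolding Q_def by (simp add: Union_components)
    show "{} \<notin> P" using ne A unfolding P_def by blast
    show "(x, y) \<in> link ?L" if "C \<in> P" "x \<in> C" "y \<in> C" for C x y
    proof (cases "C = A \<union> B")
      case True
      have "(z, head G e) \<in> link ?L" if "z \<in> A \<union> B" for z
        using that
      proof
        assume "z \<in> A" then show ?thesis using lk[OF A(1) _ A(2)] link_trans[OF _ elk] by blast
      next
        assume "z \<in> B" then show ?thesis using lk[OF B(1) _ B(2)] by blast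
      qed
      then have "(x, head G e) \<in> link ?L" "(y, head G e) \<in> link ?L" using that True by auto
      then show ?thesis by (rule link_trans[OF _ link_sym])
    next
      case False
      then have "C \<in> Q" using that unfolding P_def by auto
      then show ?thesis using that by (intro lk)
    qed
    show "tail ?L f \<in> C \<longleftrightarrow> head ?L f \<in> C" if C: "C \<in> P" and f: "f \<in> arcs ?L" for C f
    proof (cases "f = e")
      case True
      have "D = A" if "D \<in> Q" "tail G e \<in> D" for D using dis[of D A] that A by blast
      moreover have "D = B" if "D \<in> Q" "head G e \<in> D" for D using dis[of D B] that B by blast
      ultimately have "C = A \<union> B" if "tail G e \<in> C \<or> head G e \<in> C"
        using that C unfolding P_def by blast
      then show ?thesis using True A B by auto
    next
      case False
      then show ?thesis using clo[of _ f] f C A B unfolding P_def by auto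
    qed
  qed
  moreover have "A \<union> B \<notin> Q - {A, B}" using dis[of "A \<union> B" A] ne A by blast
  then have "card P = Suc (card (Q - {A, B}))" unfolding P_def using fin by simp
  moreover have "card Q = Suc (Suc (card (Q - {A, B})))"
  proof -
    have "Q = insert A (insert B (Q - {A, B}))" using A B by blast
    moreover have "card (insert A (insert B (Q - {A, B}))) = Suc (Suc (card (Q - {A, B})))"
      using \<open>A \<noteq> B\<close> fin by simp
    ultimately show ?thesis by simp
  qed
  ultimately show ?thesis unfolding num_components_def Q_def by simp
qed

text \<open>Each edge merges at most two components, starting from one component per vertex. This rules out a
truncated subtraction in the nullity.\<close>

lemma card_verts_le:
  assumes "S \<subseteq> arcs G"
  shows "card (verts G) \<le> card S + num_components (edge_subgraph G S)"
proof -
  have "finite S" using assms by (rule finite_subset) simp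
  then show ?thesis using assms
  proof (induct S rule: finite_induct)
    case empty
    have "components (edge_subgraph G {}) = (\<lambda>x. {x}) ` verts G"
      by (rule components_eqI) (auto intro: link_refl)
    then show ?case by (simp add: num_components_def card_image)
  next
    case (insert e S)
    have "num_components (edge_subgraph G S) \<le> Suc (num_components (edge_subgraph G (insert e S)))"
    proof (cases "(tail G e, head G e) \<in> link (edge_subgraph G S)")
      case True
      show ?thesis unfolding num_components_def components_insert_linked[OF insert.prems True] by simp
    next
      case False
      show ?thesis using num_components_insert_unlinked[OF insert.prems False] by simp
    qed
    moreover have "card (insert e S) = Suc (card S)" using insert.hyps by simp
    moreover have "card (verts G) \<le> card S + num_components (edge_subgraph G S)"
      using insert by blast
    ultimately show ?case by linarith
  qed
qed

lemma nullity_eq: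
  assumes "S \<subseteq> arcs G"
  shows "nullity G S + card (verts G) = card S + num_components (edge_subgraph G S)"
  using card_verts_le[OF assms] num_components_le[of "edge_subgraph G S"]
  unfolding nullity_def edge_rank_def by simp

text \<open>The recursion that identifies the nullity with the dimension of the circulation space; the proof of
\<open>circulation_basis\<close> has the same two cases.\<close>

lemma nullity_insert:
  assumes "e \<in> arcs G" "e \<notin> S" "S \<subseteq> arcs G"
  shows "nullity G (insert e S) =
    (if (tail G e, head G e) \<in> link (edge_subgraph G S) then Suc (nullity G S) else nullity G S)"
proof -
  have "finite S" using assms(3) by (rule finite_subset) simp
  then have card: "card (insert e S) = Suc (card S)" using assms by simp
  have ins: "insert e S \<subseteq> arcs G" using assms by simp
  show ?thesis
  proof (cases "(tail G e, head G e) \<in> link (edge_subgraph G S)")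
    case True
    then have "num_components (edge_subgraph G (insert e S)) = num_components (edge_subgraph G S)"
      using components_insert_linked[OF ins] unfolding num_components_def by metis
    then show ?thesis using nullity_eq[OF assms(3)] nullity_eq[OF ins] card True by simp
  next
    case False
    then show ?thesis
      using nullity_eq[OF assms(3)] nullity_eq[OF ins] card num_components_insert_unlinked[OF ins False]
      by simp
  qed
qed

lemma nullity_mono:
  assumes "S \<subseteq> T" "T \<subseteq> arcs G" shows "nullity G S \<le> nullity G T"
proof -
  have "finite (T - S)" using assms finite_arcs by (meson finite_Diff finite_subset)
  moreover have "nullity G S \<le> nullity G (S \<union> R)" if "finite R" "R \<subseteq> arcs G" for R
    using that
  proof (induct R)
    case (insert e R)
    then show ?case using nullity_insert[of e "S \<union> R"] assms
      by (cases "e \<in> S \<union> R") (auto simp: insert_absorb)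
  qed simp
  ultimately show ?thesis using assms 
    by (metis Diff_subset Un_Diff_cancel subset_trans sup.absorb2)
qed

end

section \<open>Boundaries of edge vectors\<close>

interpretation fs: vector_space "fun_scale :: 'f::field \<Rightarrow> ('i \<Rightarrow> 'f) \<Rightarrow> 'i \<Rightarrow> 'f"
  by (rule vector_space_fun_scale)

text \<open>An independent set \<open>insert z B\<close> makes each element of its span \<open>k z + x\<close> in exactly one way, with a
scalar \<open>k\<close> and \<open>x\<close> in the span of \<open>B\<close>.\<close>

lemma card_span_independent:
  fixes B :: "('i \<Rightarrow> 'f::field) set"
  assumes "finite (UNIV :: 'f set)" "finite B" "fs.independent B"
  shows "finite (fs.span B) \<and> card (fs.span B) = card (UNIV :: 'f set) ^ card B"
  using assms(2,3)
proof (induct B rule: finite_induct)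
  case empty
  then show ?case by simp
next
  case (insert z B)
  have ind: "fs.independent B" and z: "z \<notin> fs.span B"
    using insert.prems fs.independent_insert[of z B] insert.hyps by simp_all
  define h where "h = (\<lambda>(k, x). fun_scale k z + x)"
  have "inj_on h (UNIV \<times> fs.span B)"
  proof (rule inj_onI, clarsimp simp: h_def)
    fix k l x y assume xy: "x \<in> fs.span B" "y \<in> fs.span B"
      and eq: "fun_scale k z + x = fun_scale l z + y"
    then have d: "fun_scale (k - l) z = y - x"
      by (simp add: fs.scale_left_diff_distrib algebra_simps)
    have "k = l"
    proof (rule ccontr)
      assume "k \<noteq> l"
      then have "z = fun_scale (inverse (k - l)) (fun_scale (k - l) z)" by simp
      also have "\<dots> \<in> fs.span B"
        unfolding d by (intro fs.span_scale fs.span_diff xy)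
      finally show False using z by simp
    qed
    then show "k = l \<and> x = y" using eq by simp
  qed
  moreover have "h ` (UNIV \<times> fs.span B) = fs.span (insert z B)"
  proof (intro set_eqI iffI)
    fix x assume "x \<in> h ` (UNIV \<times> fs.span B)"
    then obtain k y where "x = fun_scale k z + y" "y \<in> fs.span B" by (auto simp: h_def)
    then show "x \<in> fs.span (insert z B)" unfolding fs.span_insert by (auto intro!: exI[of _ k])
  next
    fix x assume "x \<in> fs.span (insert z B)"
    then obtain k where "x - fun_scale k z \<in> fs.span B" unfolding fs.span_insert by blast
    then show "x \<in> h ` (UNIV \<times> fs.span B)"
      by (auto simp: h_def intro!: image_eqI[of _ _ "(k, x - fun_scale k z)"])
  qed
  ultimately have "bij_betw h (UNIV \<times> fs.span B) (fs.span (insert z B))"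
    by (simp add: bij_betw_def)
  moreover have "finite (fs.span B)" "card (fs.span B) = card (UNIV :: 'f set) ^ card B"
    using insert.hyps(3)[OF ind] by simp_all
  moreover have "finite ((UNIV :: 'f set) \<times> fs.span B)"
    using assms(1) \<open>finite (fs.span B)\<close> by simp
  ultimately show ?case using insert.hyps
    by (metis bij_betw_finite bij_betw_same_card card_cartesian_product card_insert_disjoint power_Suc)
qed

lemma coord_spaceD: "x \<in> coord_space I \<Longrightarrow> i \<notin> I \<Longrightarrow> x i = 0"
  by (simp add: coord_space_def)

context fin_digraph
begin

lemma boundary_eq_sum:
  fixes c :: "'b \<Rightarrow> 'f::field"
  shows "boundary G c v = (\<Sum>e\<in>arcs G. c e * (of_bool (head G e = v) - of_bool (tail G e = v)))"
proof -
  have *: "(\<Sum>e\<in>{e \<in> arcs G. P e}. c e) = (\<Sum>e\<in>arcs G. c e * of_bool (P e))" for P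
    by (simp add: sum.inter_filter of_bool_def if_distrib cong: if_cong)
  show ?thesis unfolding boundary_def in_arcs_def out_arcs_def *
    by (simp add: sum_subtractf algebra_simps)
qed

text \<open>Exchanging the two sums leaves only the net flow into \<open>U\<close>: an edge inside \<open>U\<close> is counted once with
each sign.\<close>

lemma sum_boundary:
  fixes c :: "'b \<Rightarrow> 'f::field"
  assumes "finite U"
  shows "(\<Sum>v\<in>U. boundary G c v) =
    (\<Sum>e\<in>arcs G. c e * (of_bool (head G e \<in> U) - of_bool (tail G e \<in> U)))"
proof -
  have "(\<Sum>v\<in>U. of_bool (x = v)) = (of_bool (x \<in> U) :: 'f)" for x
    using assms by (simp add: of_bool_def)
  then show ?thesis unfolding boundary_eq_sum
    by (subst sum.swap) (simp add: sum_distrib_left[symmetric] sum_subtractf)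
qed

lemma sum_boundary_closed:
  fixes c :: "'b \<Rightarrow> 'f::field"
  assumes "finite U" "c \<in> coord_space S" "\<And>e. e \<in> S \<Longrightarrow> tail G e \<in> U \<longleftrightarrow> head G e \<in> U"
  shows "(\<Sum>v\<in>U. boundary G c v) = 0"
  unfolding sum_boundary[OF assms(1)]
proof (rule sum.neutral, rule ballI)
  fix e
  show "c e * (of_bool (head G e \<in> U) - of_bool (tail G e \<in> U)) = 0"
    using assms(3) coord_spaceD[OF assms(2)] by (cases "e \<in> S") auto
qed

lemma boundary_linear:
  fixes c d :: "'b \<Rightarrow> 'f::field"
  shows "boundary G (c + d) = boundary G c + boundary G d"
    and "boundary G (c - d) = boundary G c - boundary G d"
    and "boundary G (fun_scale k c) = fun_scale k (boundary G c)"
    and "boundary G 0 = (0 :: 'a \<Rightarrow> 'f)"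
  by (simp_all add: fun_eq_iff boundary_def sum.distrib sum_subtractf fun_scale_def
      sum_distrib_left right_diff_distrib)

lemma boundary_edge_subgraph:
  fixes c :: "'b \<Rightarrow> 'f::field"
  assumes "S \<subseteq> arcs G" "c \<in> coord_space S"
  shows "boundary (edge_subgraph G S) c = boundary G c"
proof
  fix v
  have "(\<Sum>e\<in>{e \<in> S. P e}. c e) = (\<Sum>e\<in>{e \<in> arcs G. P e}. c e)" for P
    using assms by (intro sum.mono_neutral_left) (auto dest: coord_spaceD)
  then show "boundary (edge_subgraph G S) c v = boundary G c v"
    by (simp add: boundary_def in_arcs_def out_arcs_def)
qed

lemma flows_edge_subgraph:
  "S \<subseteq> arcs G \<Longrightarrow> flows (edge_subgraph G S) b = {c \<in> coord_space S. boundary G c = b}"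
  by (auto simp: flows_def boundary_edge_subgraph)

lemma boundary_space_edge_subgraph:
  "S \<subseteq> arcs G \<Longrightarrow> boundary_space (edge_subgraph G S) = boundary G ` coord_space S"
  by (simp add: boundary_space_def boundary_edge_subgraph)

lemma boundary_space_iff_flows:
  "b \<in> boundary_space K \<longleftrightarrow> flows K b \<noteq> {}"
  by (auto simp: boundary_space_def flows_def)

text \<open>One unit is sent along a path from \<open>u\<close> to \<open>v\<close>, with a negative sign on the edges that are passed
against their orientation.\<close>

lemma ex_path_flow:
  assumes "S \<subseteq> arcs G" "(u, v) \<in> link (edge_subgraph G S)"
  shows "\<exists>c \<in> coord_space S. boundary G c = (\<lambda>w. of_bool (w = v) - of_bool (w = u) :: 'f::field)"
  using assms(2)[unfolded link_def]
proof (induct rule: rtrancl_on_induct)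
  case base
  have "(0 :: 'b \<Rightarrow> 'f) \<in> coord_space S" by (simp add: coord_space_def)
  then show ?case by (auto intro!: bexI[of _ 0] simp: boundary_linear fun_eq_iff)
next
  case (step y z)
  then obtain c :: "'b \<Rightarrow> 'f" where c: "c \<in> coord_space S"
    "boundary G c = (\<lambda>w. of_bool (w = y) - of_bool (w = u))" by blast
  obtain e where e: "e \<in> S" "(y, z) = (tail G e, head G e) \<or> (y, z) = (head G e, tail G e)"
    using step(2) by (auto simp: ends_rel_def)
  define d :: "'b \<Rightarrow> 'f" where "d = (\<lambda>f. of_bool (f = e))"
  have dS: "d \<in> coord_space S" using e by (auto simp: d_def coord_space_def)
  have d: "boundary G d w = of_bool (w = head G e) - of_bool (w = tail G e)" for w
  proof -
    have "e \<in> arcs G" using e assms by blast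
    then show ?thesis unfolding boundary_eq_sum d_def
      by (simp add: of_bool_def if_distrib[of "\<lambda>x. x * _"] eq_commute cong: if_cong)
  qed
  from e(2) show ?case
  proof
    assume "(y, z) = (tail G e, head G e)"
    then have "boundary G (c + d) = (\<lambda>w. of_bool (w = z) - of_bool (w = u))"
      unfolding boundary_linear c(2) by (simp add: fun_eq_iff d)
    moreover have "c + d \<in> coord_space S" using c dS by (simp add: coord_space_def)
    ultimately show ?thesis by blast
  next
    assume "(y, z) = (head G e, tail G e)"
    then have "boundary G (c - d) = (\<lambda>w. of_bool (w = z) - of_bool (w = u))"
      unfolding boundary_linear c(2) by (simp add: fun_eq_iff d)
    moreover have "c - d \<in> coord_space S" using c dS by (simp add: coord_space_def)
    ultimately show ?thesis by blast
  qed
qed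

text \<open>Necessity holds because no edge leaves a component. For sufficiency, the value \<open>b v\<close> is produced at
\<open>v\<close> by a path flow from a representative of its component; at the representative the contributions
add up to the sum of \<open>b\<close> over the component, which vanishes.\<close>

lemma boundary_space_iff:
  fixes b :: "'a \<Rightarrow> 'f::field"
  assumes S: "S \<subseteq> arcs G"
  shows "b \<in> boundary_space (edge_subgraph G S) \<longleftrightarrow>
    b \<in> coord_space (verts G) \<and> b_compatible b (edge_subgraph G S)"
proof
  assume "b \<in> boundary_space (edge_subgraph G S)"
  then obtain c where c: "c \<in> coord_space S" "b = boundary G c"
    by (auto simp: boundary_space_edge_subgraph[OF S])
  have "b v = 0" if "v \<notin> verts G" for v
    using that by (auto simp: c(2) boundary_eq_sum intro!: sum.neutral)
  moreover have "(\<Sum>v\<in>U. b v) = 0" if U: "U \<in> components (edge_subgraph G S)" for U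
    unfolding c(2)
  proof (rule sum_boundary_closed[OF _ c(1)])
    have "U \<subseteq> verts G" using U Union_components[of "edge_subgraph G S"] by auto
    then show "finite U" by (rule finite_subset) simp
    show "tail G e \<in> U \<longleftrightarrow> head G e \<in> U" if "e \<in> S" for e
      using component_closed[OF wf_edge_subgraph[OF S] U] that by simp
  qed
  ultimately show "b \<in> coord_space (verts G) \<and> b_compatible b (edge_subgraph G S)"
    by (simp add: coord_space_def b_compatible_def)
next
  let ?L = "link (edge_subgraph G S)"
  assume b: "b \<in> coord_space (verts G) \<and> b_compatible b (edge_subgraph G S)"
  \<comment> \<open>The choice depends only on the class of \<open>v\<close>, so all vertices of a component share one representative.\<close>
  define rep where "rep v = (SOME x. x \<in> ?L `` {v})" for v
  have rep: "(v, rep v) \<in> ?L" if "v \<in> verts G" for v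
    unfolding rep_def using someI[of "\<lambda>x. x \<in> ?L `` {v}" v] that link_refl[of v "edge_subgraph G S"]
    by simp
  have rep_eq: "rep v = rep w" if "(v, w) \<in> ?L" for v w
  proof -
    have "?L `` {v} = ?L `` {w}" using that by (auto intro: link_sym link_trans)
    then show ?thesis by (simp add: rep_def)
  qed
  have "\<forall>v\<in>verts G. \<exists>c. c \<in> coord_space S \<and>
    boundary G c = (\<lambda>w. of_bool (w = v) - of_bool (w = rep v) :: 'f)"
    using ex_path_flow[OF S link_sym[OF rep]] by blast
  then obtain c :: "'a \<Rightarrow> 'b \<Rightarrow> 'f" where c: "\<And>v. v \<in> verts G \<Longrightarrow> c v \<in> coord_space S"
    "\<And>v. v \<in> verts G \<Longrightarrow> boundary G (c v) = (\<lambda>w. of_bool (w = v) - of_bool (w = rep v))"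
    by metis
  define d where "d = (\<lambda>e. \<Sum>v\<in>verts G. b v * c v e)"
  have "d \<in> coord_space S"
    using c(1) by (auto simp: d_def coord_space_def intro!: sum.neutral)
  moreover have "boundary G d w = b w" for w
  proof -
    have "boundary G d w = (\<Sum>v\<in>verts G. b v * boundary G (c v) w)"
      unfolding boundary_eq_sum d_def sum_distrib_right sum_distrib_left
      by (subst sum.swap) (simp add: mult.assoc)
    also have "\<dots> = (\<Sum>v\<in>verts G. b v * (of_bool (w = v) - of_bool (w = rep v)))"
      by (rule sum.cong) (auto simp: c(2))
    also have "\<dots> = (\<Sum>v\<in>verts G. b v * of_bool (w = v)) - (\<Sum>v\<in>verts G. b v * of_bool (w = rep v))"
      by (simp add: right_diff_distrib sum_subtractf)
    also have "(\<Sum>v\<in>verts G. b v * of_bool (w = v)) = b w"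
      using b by (auto simp: of_bool_def if_distrib coord_space_def cong: if_cong)
    also have "(\<Sum>v\<in>verts G. b v * of_bool (w = rep v)) = (\<Sum>v\<in>{v \<in> verts G. w = rep v}. b v)"
      by (simp add: sum.inter_filter of_bool_def if_distrib cong: if_cong)
    also have "\<dots> = 0"
    proof (cases "\<exists>x\<in>verts G. w = rep x")
      case True
      then obtain x where x: "x \<in> verts G" "w = rep x" by blast
      have "{v \<in> verts G. w = rep v} = ?L `` {x}"
      proof (intro set_eqI iffI)
        fix v assume "v \<in> {v \<in> verts G. w = rep v}"
        then have "(v, rep x) \<in> ?L" using rep[of v] x by simp
        then show "v \<in> ?L `` {x}" using link_trans[OF rep[OF x(1)] link_sym] by blast
      next
        fix v assume "v \<in> ?L `` {x}"
        then show "v \<in> {v \<in> verts G. w = rep v}"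
          using rep_eq[of x v] x link_verts[of x v "edge_subgraph G S"] by simp
      qed
      moreover have "?L `` {x} \<in> components (edge_subgraph G S)"
        using x unfolding components_eq_quotient by (simp add: quotientI)
      ultimately show ?thesis using b by (simp add: b_compatible_def)
    next
      case False
      then show ?thesis by (auto intro!: sum.neutral)
    qed
    finally show ?thesis by simp
  qed
  then have "boundary G d = b" by blast
  ultimately show "b \<in> boundary_space (edge_subgraph G S)"
    unfolding boundary_space_edge_subgraph[OF S] by blast
qed

text \<open>The vertices reachable from the tail without \<open>e\<close> form a set that only \<open>e\<close> leaves, so the net flow out
of this set is \<open>c e\<close>.\<close>

lemma circulation_bridge_zero:
  fixes c :: "'b \<Rightarrow> 'f::field"
  assumes ins: "insert e S \<subseteq> arcs G" and c: "c \<in> coord_space (insert e S)" "boundary G c = 0"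
    and nl: "(tail G e, head G e) \<notin> link (edge_subgraph G S)"
  shows "c e = 0"
proof -
  define U where "U = link (edge_subgraph G S) `` {tail G e}"
  have t: "tail G e \<in> U" using ins unfolding U_def by (auto intro: link_refl)
  have "U \<subseteq> verts G" unfolding U_def using link_verts by fastforce
  then have "finite U" by (rule finite_subset) simp
  have "U \<in> components (edge_subgraph G S)"
    unfolding components_eq_quotient U_def using ins by (auto intro: quotientI)
  then have closed: "tail G f \<in> U \<longleftrightarrow> head G f \<in> U" if "f \<in> S" for f
    using component_closed[OF wf_edge_subgraph, of S U f] that ins by simp
  have "0 = (\<Sum>v\<in>U. boundary G c v)" using c by simp
  also have "\<dots> = (\<Sum>f\<in>arcs G. c f * (of_bool (head G f \<in> U) - of_bool (tail G f \<in> U)))"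
    by (rule sum_boundary[OF \<open>finite U\<close>])
  also have "\<dots> = (\<Sum>f\<in>{e}. c f * (of_bool (head G f \<in> U) - of_bool (tail G f \<in> U)))"
    using ins c(1) closed by (intro sum.mono_neutral_right) (auto dest: coord_spaceD)
  also have "\<dots> = - c e" using t nl by (simp add: U_def)
  finally show ?thesis by simp
qed

end

section \<open>Dimension and size of the affine flow spaces\<close>

context fin_digraph
begin

text \<open>A path flow from the head back to the tail is closed up by one unit on \<open>e\<close>.\<close>

lemma ex_circulation_through:
  assumes S: "S \<subseteq> arcs G" and e: "e \<in> arcs G" "e \<notin> S"
    and linked: "(tail G e, head G e) \<in> link (edge_subgraph G S)"
  shows "\<exists>z \<in> coord_space (insert e S). boundary G z = (0 :: 'a \<Rightarrow> 'f::field) \<and> z e = 1"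
proof -
  obtain p :: "'b \<Rightarrow> 'f" where p: "p \<in> coord_space S"
    "boundary G p = (\<lambda>w. of_bool (w = tail G e) - of_bool (w = head G e))"
    using ex_path_flow[OF S link_sym[OF linked]] by blast
  define z where "z = p(e := 1)"
  have pe: "p e = 0" using coord_spaceD[OF p(1) e(2)] .
  have "z \<in> coord_space (insert e S)" "z e = 1"
    using p by (auto simp: z_def coord_space_def)
  moreover have "boundary G z = 0"
  proof
    fix w
    have "boundary G z w = (\<Sum>f\<in>arcs G. p f * (of_bool (head G f = w) - of_bool (tail G f = w)) +
      (if f = e then of_bool (head G e = w) - of_bool (tail G e = w) else 0))"
      unfolding boundary_eq_sum by (rule sum.cong) (auto simp: z_def pe)
    also have "\<dots> = boundary G p w + (of_bool (head G e = w) - of_bool (tail G e = w))"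
      unfolding sum.distrib boundary_eq_sum using e by simp
    finally show "boundary G z w = 0 w" 
      unfolding p(2) by (cases "w = tail G e"; cases "w = head G e") auto
  qed
  ultimately show ?thesis by blast
qed

text \<open>Induction over the edges, along \<open>nullity_insert\<close>. An edge that closes a cycle adds one basis vector, a
circulation with value one on it, by which every circulation can be cleared there; any other edge leaves
the space unchanged. A basis is carried along, rather than the dimension, since it also gives the
number of elements over a finite field.\<close>

lemma circulation_basis:
  fixes S :: "'b set"
  assumes "S \<subseteq> arcs G"
  shows "\<exists>B :: ('b \<Rightarrow> 'f::field) set. finite B \<and> fs.independent B \<and> card B = nullity G S \<and>
    fs.span B = flows (edge_subgraph G S) 0"
proof -
  have "finite S" using assms by (rule finite_subset) simp
  then show ?thesis using assms
  proof (induct S rule: finite_induct)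
    case empty
    have "nullity G {} = 0" by (simp add: nullity_def)
    moreover have "flows (edge_subgraph G {}) 0 = {0 :: 'b \<Rightarrow> 'f}"
      by (auto simp: flows_edge_subgraph coord_space_def boundary_linear)
    ultimately show ?case
      by (intro exI[of _ "{}"]) (simp only: fs.independent_empty fs.span_empty finite.emptyI card.empty simp_thms)
  next
    case (insert e S)
    then have S: "S \<subseteq> arcs G" and e: "e \<in> arcs G" by auto
    obtain B :: "('b \<Rightarrow> 'f) set" where B: "finite B" "fs.independent B" "card B = nullity G S"
      "fs.span B = flows (edge_subgraph G S) 0"
      using insert by blast
    note flows_S = flows_edge_subgraph[OF S] and flows_eS = flows_edge_subgraph[OF insert.prems]
    show ?case
    proof (cases "(tail G e, head G e) \<in> link (edge_subgraph G S)")
      case True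
      obtain z :: "'b \<Rightarrow> 'f" where z: "z \<in> coord_space (insert e S)" "z e = 1"
        and bz: "boundary G z = 0"
        using ex_circulation_through[OF S e insert.hyps(2) True] by blast
      have znot: "z \<notin> fs.span B"
        unfolding B(4) flows_S using z(2) insert.hyps(2) by (auto dest: coord_spaceD)
      then have "z \<notin> B" using fs.span_base by blast
      have "fs.span (insert z B) = flows (edge_subgraph G (insert e S)) 0"
      proof (intro set_eqI iffI)
        fix x assume "x \<in> fs.span (insert z B)"
        then obtain k where "x - fun_scale k z \<in> flows (edge_subgraph G S) 0"
          unfolding fs.span_insert B(4) by blast
        then have k: "x - fun_scale k z \<in> coord_space S" "boundary G (x - fun_scale k z) = 0"
          by (auto simp: flows_S)
        have "x i = 0" if "i \<notin> insert e S" for i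
          using coord_spaceD[OF k(1), of i] coord_spaceD[OF z(1), of i] that
          by (simp add: fun_scale_def)
        moreover have "boundary G x = 0"
          using k(2) by (simp add: boundary_linear bz)
        ultimately show "x \<in> flows (edge_subgraph G (insert e S)) 0"
          by (simp add: flows_eS coord_space_def)
      next
        fix x :: "'b \<Rightarrow> 'f" assume "x \<in> flows (edge_subgraph G (insert e S)) 0"
        then have x: "x \<in> coord_space (insert e S)" "boundary G x = 0" by (auto simp: flows_eS)
        have "(x - fun_scale (x e) z) i = 0" if "i \<notin> S" for i
          using that z coord_spaceD[OF x(1), of i] coord_spaceD[OF z(1), of i]
          by (cases "i = e") (auto simp: fun_scale_def)
        moreover have "boundary G (x - fun_scale (x e) z) = 0"
          by (simp add: boundary_linear bz x)
        ultimately have "x - fun_scale (x e) z \<in> flows (edge_subgraph G S) 0"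
          by (simp add: flows_S coord_space_def)
        then show "x \<in> fs.span (insert z B)" unfolding fs.span_insert B(4) by blast
      qed
      moreover have "fs.independent (insert z B)"
        using B(2) znot by (simp add: fs.independent_insert)
      moreover have "card (insert z B) = nullity G (insert e S)"
        using nullity_insert[OF e insert.hyps(2) S] True B \<open>z \<notin> B\<close> by simp
      moreover have "finite (insert z B)" using B(1) by simp
      ultimately show ?thesis by (intro exI[of _ "insert z B"] conjI)
    next
      case False
      have "flows (edge_subgraph G (insert e S)) (0 :: 'a \<Rightarrow> 'f) = flows (edge_subgraph G S) 0"
      proof (intro set_eqI iffI)
        fix c :: "'b \<Rightarrow> 'f" assume "c \<in> flows (edge_subgraph G (insert e S)) 0"
        then have c: "c \<in> coord_space (insert e S)" "boundary G c = 0" by (auto simp: flows_eS)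
        then have "c e = 0" by (rule circulation_bridge_zero[OF insert.prems _ _ False])
        then show "c \<in> flows (edge_subgraph G S) 0"
          using c by (auto simp: flows_S coord_space_def)
      next
        fix c :: "'b \<Rightarrow> 'f" assume "c \<in> flows (edge_subgraph G S) 0"
        then show "c \<in> flows (edge_subgraph G (insert e S)) 0"
          by (auto simp: flows_S flows_eS coord_space_def)
      qed
      then have "fs.span B = flows (edge_subgraph G (insert e S)) 0" using B(4) by (rule trans[rotated, OF sym])
      moreover have "card B = nullity G (insert e S)"
        using nullity_insert[OF e insert.hyps(2) S] False B(3) by simp
      ultimately show ?thesis using B(1,2) by (intro exI[of _ B] conjI)
    qed
  qed
qed

lemma flows_translate:
  assumes "S \<subseteq> arcs G" "c \<in> flows (edge_subgraph G S) b"
  shows "flows (edge_subgraph G S) b = (\<lambda>z. z + c) ` flows (edge_subgraph G S) 0"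
proof (intro set_eqI iffI)
  fix x assume "x \<in> flows (edge_subgraph G S) b"
  then have "x - c \<in> flows (edge_subgraph G S) 0"
    using assms by (simp add: flows_edge_subgraph coord_space_def boundary_linear)
  then show "x \<in> (\<lambda>z. z + c) ` flows (edge_subgraph G S) 0"
    by (intro image_eqI[of _ _ "x - c"]) simp_all
next
  fix x assume "x \<in> (\<lambda>z. z + c) ` flows (edge_subgraph G S) 0"
  then show "x \<in> flows (edge_subgraph G S) b"
    using assms by (auto simp: flows_edge_subgraph coord_space_def boundary_linear)
qed

lemma affine_dim_flows:
  fixes b :: "'a \<Rightarrow> 'f::field"
  assumes S: "S \<subseteq> arcs G" and ne: "flows (edge_subgraph G S) b \<noteq> {}"
  shows "affine_dim (flows (edge_subgraph G S) b) = nullity G S"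
proof -
  obtain B :: "('b \<Rightarrow> 'f) set" where B: "fs.independent B" "card B = nullity G S"
    "fs.span B = flows (edge_subgraph G S) 0"
    using circulation_basis[OF S] by blast
  obtain c where c: "c \<in> flows (edge_subgraph G S) b" using ne by blast
  have "{x - y |x y. x \<in> flows (edge_subgraph G S) b \<and> y \<in> flows (edge_subgraph G S) b} =
    flows (edge_subgraph G S) 0" (is "?D = ?Z")
  proof (intro set_eqI iffI)
    fix z assume "z \<in> ?D"
    then show "z \<in> ?Z" using S by (auto simp: flows_edge_subgraph coord_space_def boundary_linear)
  next
    fix z assume "z \<in> ?Z"
    then have "z + c \<in> flows (edge_subgraph G S) b" using flows_translate[OF S c] by blast
    moreover have "z = (z + c) - c" by simp
    ultimately show "z \<in> ?D" using c by blast
  qed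
  then show ?thesis
    unfolding affine_dim_def
    using fs.dim_unique[of B "fs.span B" "nullity G S"] B fs.span_superset[of B] by simp
qed

lemma card_flows:
  fixes b :: "'a \<Rightarrow> 'f::field"
  assumes fin: "finite (UNIV :: 'f set)" and S: "S \<subseteq> arcs G"
    and ne: "flows (edge_subgraph G S) b \<noteq> {}"
  shows "finite (flows (edge_subgraph G S) b)"
    and "card (flows (edge_subgraph G S) b) = card (UNIV :: 'f set) ^ nullity G S"
proof -
  obtain B :: "('b \<Rightarrow> 'f) set" where B: "finite B" "fs.independent B" "card B = nullity G S"
    "fs.span B = flows (edge_subgraph G S) 0"
    using circulation_basis[OF S] by blast
  obtain c where c: "c \<in> flows (edge_subgraph G S) b" using ne by blast
  have "inj_on (\<lambda>z. z + c) (flows (edge_subgraph G S) 0)" by (simp add: inj_on_def)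
  then show "finite (flows (edge_subgraph G S) b)"
    "card (flows (edge_subgraph G S) b) = card (UNIV :: 'f set) ^ nullity G S"
    using card_span_independent[OF fin B(1,2)] B(3,4)
    unfolding flows_translate[OF S c] by (simp_all add: card_image)
qed

end

section \<open>Cycles and cut-edges\<close>

definition simple_path :: "('v, 'e) pre_digraph \<Rightarrow> 'v \<Rightarrow> 'v \<Rightarrow> 'v list \<Rightarrow> 'e list \<Rightarrow> bool" where
  "simple_path K u v vs es \<longleftrightarrow> length vs = Suc (length es) \<and> distinct vs \<and> vs ! 0 = u \<and>
     vs ! length es = v \<and> set vs \<subseteq> verts K \<and> set es \<subseteq> arcs K \<and>
     (\<forall>i < length es. {tail K (es ! i), head K (es ! i)} = {vs ! i, vs ! Suc i})"

text \<open>Consecutive pairs of vertices on a path without repeated vertices are distinct as unordered pairs,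
so no edge can be used twice.\<close>

lemma simple_path_distinct_arcs:
  assumes "simple_path K u v vs es" shows "distinct es"
proof -
  have "i = j" if "i < length es" "j < length es" "es ! i = es ! j" for i j
  proof -
    have "{vs ! i, vs ! Suc i} = {vs ! j, vs ! Suc j}"
      using assms that unfolding simple_path_def by metis
    moreover have "vs ! k = vs ! l \<longleftrightarrow> k = l" if "k \<le> length es" "l \<le> length es" for k l
      using assms that unfolding simple_path_def by (simp add: nth_eq_iff_index_eq)
    ultimately show ?thesis using that by (auto simp: doubleton_eq_iff)
  qed
  then show ?thesis by (auto simp: distinct_conv_nth)
qed

text \<open>A path is extended edge by edge; if the new vertex has occurred before, the path is cut back to that
occurrence.\<close>

lemma link_imp_simple_path:
  assumes "(u, v) \<in> link K"
  shows "\<exists>vs es. simple_path K u v vs es"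
  using assms[unfolded link_def]
proof (induct rule: rtrancl_on_induct)
  case base
  then show ?case by (intro exI[of _ "[u]"] exI[of _ "[]"]) (simp add: simple_path_def)
next
  case (step y z)
  then obtain vs es where p: "simple_path K u y vs es" by blast
  obtain e where e: "e \<in> arcs K" "{tail K e, head K e} = {y, z}"
    using step(2) by (auto simp: ends_rel_def)
  show ?case
  proof (cases "z \<in> set vs")
    case True
    then obtain k where "k < length vs" "vs ! k = z" by (auto simp: in_set_conv_nth)
    then have k: "k \<le> length es" "vs ! k = z" using p unfolding simple_path_def by auto
    then have "length (take k es) = k" by simp
    then have "simple_path K u z (take (Suc k) vs) (take k es)"
      using p k unfolding simple_path_def
      by (auto dest: in_set_takeD simp del: length_take) (simp add: length_take)
    then show ?thesis by blast
  next
    case False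
    have "simple_path K u z (vs @ [z]) (es @ [e])"
      using p e False step(4) unfolding simple_path_def
      by (auto simp: nth_append less_Suc_eq)
    then show ?thesis by blast
  qed
qed

context fin_digraph
begin

text \<open>The rest of the cycle joins the two ends of \<open>e\<close>: it starts at the successor of the position \<open>k\<close> of
\<open>e\<close> and runs around to \<open>k\<close>.\<close>

lemma cycle_imp_linked:
  assumes cyc: "undirected_cycle G vs es" and e: "e \<in> set es"
  shows "(tail G e, head G e) \<in> link (edge_subgraph G (arcs G - {e}))"
proof -
  let ?K = "edge_subgraph G (arcs G - {e})"
  let ?n = "length es"
  have len: "length vs = ?n" and sub: "set vs \<subseteq> verts G" "set es \<subseteq> arcs G"
    and dist: "distinct es"
    and ends: "\<And>i. i < ?n \<Longrightarrow> {tail G (es ! i), head G (es ! i)} = {vs ! i, vs ! (Suc i mod ?n)}"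
    using cyc unfolding undirected_cycle_def by auto
  obtain k where k: "k < ?n" "es ! k = e" using e by (auto simp: in_set_conv_nth)
  have wf: "wf_digraph ?K" by (rule wf_edge_subgraph) blast
  have n: "0 < ?n" using k by linarith
  \<comment> \<open>For \<open>j < n\<close> the positions \<open>k + 1, ..., k + j\<close> differ from \<open>k\<close> modulo \<open>n\<close>, so the walk avoids \<open>e\<close>.\<close>
  have walk: "j < ?n \<Longrightarrow> (vs ! (Suc k mod ?n), vs ! ((Suc k + j) mod ?n)) \<in> link ?K" for j
  proof (induct j)
    case 0
    have "vs ! (Suc k mod ?n) \<in> set vs" using n len by (intro nth_mem) simp
    then have "vs ! (Suc k mod ?n) \<in> verts ?K" using sub by auto
    then show ?case using link_refl[of "vs ! (Suc k mod ?n)" ?K] by simp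
  next
    case (Suc j)
    let ?i = "(Suc k + j) mod ?n"
    have i: "?i < ?n" using n by simp
    have "?i \<noteq> k"
    proof
      assume "?i = k"
      then show False using Suc.prems k by (auto simp: mod_if split: if_splits)
    qed
    then have "es ! ?i \<in> arcs ?K"
      using k i sub dist by (auto simp: nth_eq_iff_index_eq)
    then have "(tail G (es ! ?i), head G (es ! ?i)) \<in> link ?K" using link_arc[OF wf] by fastforce
    then have "(vs ! ?i, vs ! (Suc ?i mod ?n)) \<in> link ?K"
      using ends[OF i] link_sym by (auto simp: doubleton_eq_iff)
    moreover have "Suc ?i mod ?n = (Suc k + Suc j) mod ?n" by (simp add: mod_Suc_eq)
    ultimately show ?case using Suc link_trans by (metis Suc_lessD)
  qed
  have "(vs ! (Suc k mod ?n), vs ! k) \<in> link ?K"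
  proof -
    have "(Suc k + (?n - 1)) mod ?n = (k + ?n) mod ?n" using k by (intro arg_cong[of _ _ "\<lambda>x. x mod ?n"]) simp
    then have "(Suc k + (?n - 1)) mod ?n = k" using k by simp
    then show ?thesis using walk[of "?n - 1"] k by simp
  qed
  then show ?thesis using ends[OF k(1)] k link_sym by (auto simp: doubleton_eq_iff)
qed

text \<open>A simple path from the tail to the head that avoids \<open>e\<close> is closed by \<open>e\<close>. If \<open>e\<close> is a loop, the path has
one vertex and no edge.\<close>

lemma linked_imp_cycle:
  assumes "e \<in> arcs G" "(tail G e, head G e) \<in> link (edge_subgraph G (arcs G - {e}))"
  shows "e \<in> E_cyc G"
proof -
  obtain vs es where p: "simple_path (edge_subgraph G (arcs G - {e})) (tail G e) (head G e) vs es"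
    using link_imp_simple_path[OF assms(2)] by blast
  have "undirected_cycle G vs (es @ [e])"
    unfolding undirected_cycle_def
  proof (intro conjI allI impI)
    fix i assume "i < length (es @ [e])"
    then consider "i < length es" | "i = length es" by fastforce
    then show "{tail G ((es @ [e]) ! i), head G ((es @ [e]) ! i)} =
        {vs ! i, vs ! (Suc i mod length (es @ [e]))}"
    proof cases
      case 1
      then have "Suc i mod length (es @ [e]) = Suc i" by simp
      then show ?thesis using 1 p by (simp add: simple_path_def nth_append)
    next
      case 2
      then show ?thesis using p by (auto simp: simple_path_def)
    qed
  qed (use p simple_path_distinct_arcs[OF p] assms(1) in \<open>auto simp: simple_path_def\<close>)
  moreover have "e \<in> set (es @ [e])" by simp
  ultimately show ?thesis using assms(1) unfolding E_cyc_def by blast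
qed

text \<open>From here on, cycles are used only through this criterion.\<close>

lemma E_cyc_iff:
  "e \<in> E_cyc G \<longleftrightarrow> e \<in> arcs G \<and> (tail G e, head G e) \<in> link (edge_subgraph G (arcs G - {e}))"
  using linked_imp_cycle cycle_imp_linked by (auto simp: E_cyc_def)

lemma E_cut_iff:
  "e \<in> E_cut G \<longleftrightarrow> e \<in> arcs G \<and> (tail G e, head G e) \<notin> link (edge_subgraph G (arcs G - {e}))"
  by (auto simp: E_cut_def E_cyc_iff)

lemma E_cut_subset: "E_cut G \<subseteq> arcs G"
  by (auto simp: E_cut_def)

lemma nullity_insert_cut:
  assumes "e \<in> E_cut G" "S \<subseteq> arcs G"
  shows "nullity G (insert e S) = nullity G S"
proof (cases "e \<in> S")
  case False
  have "(tail G e, head G e) \<notin> link (edge_subgraph G S)"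
    using assms False link_subset_mono[of _ _ S "arcs G - {e}"] by (auto simp: E_cut_iff)
  then show ?thesis using nullity_insert[of e S] assms False by (auto simp: E_cut_iff)
qed (simp add: insert_absorb)

lemma nullity_Un_cut:
  assumes "C \<subseteq> E_cut G" "S \<subseteq> arcs G"
  shows "nullity G (S \<union> C) = nullity G S"
proof -
  have "finite C" using assms(1) E_cut_subset finite_arcs by (meson finite_subset)
  then show ?thesis using assms
  proof (induct C rule: finite_induct)
    case (insert e C)
    then show ?case using nullity_insert_cut[of e "S \<union> C"] E_cut_subset by auto
  qed simp
qed

text \<open>An edge outside \<open>S\<close> lies on a cycle of the whole graph, so its deletion already lowers the nullity.\<close>

lemma nullity_less:
  assumes "E_cut G \<subseteq> S" "S \<subset> arcs G"
  shows "nullity G S < nullity G (arcs G)"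
proof -
  obtain e where e: "e \<in> arcs G" "e \<notin> S" using assms by blast
  then have "(tail G e, head G e) \<in> link (edge_subgraph G (arcs G - {e}))"
    using assms(1) by (auto simp: E_cut_iff)
  then have "nullity G (arcs G) = Suc (nullity G (arcs G - {e}))"
    using nullity_insert[of e "arcs G - {e}"] e by (simp add: insert_absorb)
  moreover have "nullity G S \<le> nullity G (arcs G - {e})"
    using assms e by (intro nullity_mono) auto
  ultimately show ?thesis by simp
qed

lemma E_cut_flow_eq:
  fixes c d :: "'b \<Rightarrow> 'f::field"
  assumes "e \<in> E_cut G" "c \<in> flows G b" "d \<in> flows G b"
  shows "c e = d e"
proof -
  have "(c - d) e = 0"
  proof (rule circulation_bridge_zero)
    show "insert e (arcs G - {e}) \<subseteq> arcs G" using assms by (auto simp: E_cut_iff)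
    show "c - d \<in> coord_space (insert e (arcs G - {e}))" "boundary G (c - d) = 0"
      using assms(2,3) by (auto simp: flows_def coord_space_def boundary_linear)
    show "(tail G e, head G e) \<notin> link (edge_subgraph G (arcs G - {e}))"
      using assms by (auto simp: E_cut_iff)
  qed
  then show ?thesis by simp
qed

lemma E_cyc_ex_circulation:
  assumes "e \<in> E_cyc G"
  shows "\<exists>z \<in> flows G 0. z e = (1 :: 'f::field)"
proof -
  have e: "e \<in> arcs G" "(tail G e, head G e) \<in> link (edge_subgraph G (arcs G - {e}))"
    using assms by (auto simp: E_cyc_iff)
  obtain z :: "'b \<Rightarrow> 'f" where "z \<in> coord_space (insert e (arcs G - {e}))" "boundary G z = 0" "z e = 1"
    using ex_circulation_through[OF _ e(1) _ e(2)] by blast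
  moreover have "insert e (arcs G - {e}) = arcs G" using e by blast
  ultimately show ?thesis by (intro bexI[of _ z]) (auto simp: flows_def)
qed

end

section \<open>Alternating sums and inclusion-exclusion\<close>

text \<open>For \<open>a \<notin> A\<close> the subsets are paired by adding \<open>a\<close>. The formula survives for \<open>a \<in> A\<close>, where the terms
with \<open>a \<in> B\<close> on the right vanish; this case is what makes repeated hyperplanes harmless.\<close>

lemma alternating_sum_insert:
  fixes g :: "'a set \<Rightarrow> 'c::comm_ring_1"
  assumes "finite A"
  shows "(\<Sum>B\<in>Pow (insert a A). (-1) ^ card B * g B) =
    (\<Sum>B\<in>Pow A. (-1) ^ card B * (g B - g (insert a B)))"
proof -
  have new: "(\<Sum>B\<in>Pow (insert a A). (-1) ^ card B * g B) =
      (\<Sum>B\<in>Pow A. (-1) ^ card B * (g B - g (insert a B)))"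
    if "finite A" "a \<notin> A" for A and g :: "'a set \<Rightarrow> 'c"
  proof -
    have card: "card (insert a B) = Suc (card B)" if "B \<in> Pow A" for B
      using that \<open>finite A\<close> \<open>a \<notin> A\<close> by (metis PowD card_insert_disjoint finite_subset subsetD)
    have inj: "inj_on (insert a) (Pow A)"
      using \<open>a \<notin> A\<close> by (intro inj_onI) (metis PowD insert_ident subsetD)
    have "(\<Sum>B\<in>Pow (insert a A). (-1) ^ card B * g B) =
        (\<Sum>B\<in>Pow A. (-1) ^ card B * g B) + (\<Sum>B\<in>insert a ` Pow A. (-1) ^ card B * g B)"
      unfolding Pow_insert using that by (intro sum.union_disjoint) auto
    also have "(\<Sum>B\<in>insert a ` Pow A. (-1) ^ card B * g B) =
        (\<Sum>B\<in>Pow A. (-1) ^ card (insert a B) * g (insert a B))"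
      by (subst sum.reindex[OF inj]) simp
    also have "\<dots> = (\<Sum>B\<in>Pow A. - ((-1) ^ card B * g (insert a B)))"
      by (rule sum.cong) (simp_all add: card)
    finally show ?thesis by (simp add: sum_negf right_diff_distrib sum_subtractf)
  qed
  show ?thesis
  proof (cases "a \<in> A")
    case False
    then show ?thesis using assms new by blast
  next
    case True
    let ?A = "A - {a}"
    have A: "insert a ?A = A" using True by blast
    have "(\<Sum>B\<in>Pow A. (-1) ^ card B * (g B - g (insert a B))) =
        (\<Sum>B\<in>Pow ?A. (-1) ^ card B *
          ((g B - g (insert a B)) - (g (insert a B) - g (insert a (insert a B)))))"
      using new[of ?A "\<lambda>B. g B - g (insert a B)"] assms unfolding A by simp
    also have "\<dots> = (\<Sum>B\<in>Pow A. (-1) ^ card B * g B)"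
      using new[of ?A g] assms unfolding A by simp
    finally show ?thesis using True by (simp add: insert_absorb)
  qed
qed

text \<open>The subsets of \<open>E\<close> with a given image \<open>B\<close> have signs that add up to \<open>(-1)^|B|\<close>. The induction avoids
this count: adding an element to \<open>E\<close> has the same effect on both sides, whether or not its image is new.\<close>

lemma alternating_sum_image:
  fixes g :: "'b set \<Rightarrow> 'c::comm_ring_1"
  assumes "finite E"
  shows "(\<Sum>B\<in>Pow (f ` E). (-1) ^ card B * g B) = (\<Sum>S\<in>Pow E. (-1) ^ card S * g (f ` S))"
  using assms
proof (induct E arbitrary: g rule: finite_induct)
  case (insert e E)
  have "(\<Sum>B\<in>Pow (f ` insert e E). (-1) ^ card B * g B) =
      (\<Sum>B\<in>Pow (f ` E). (-1) ^ card B * (g B - g (insert (f e) B)))"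
    using insert.hyps(1) by (simp add: alternating_sum_insert)
  also have "\<dots> = (\<Sum>S\<in>Pow E. (-1) ^ card S * (g (f ` S) - g (f ` (insert e S))))"
    by (simp add: insert.hyps(3))
  also have "\<dots> = (\<Sum>S\<in>Pow (insert e E). (-1) ^ card S * g (f ` S))"
    using alternating_sum_insert[OF insert.hyps(1), where a = e and g = "\<lambda>S. g (f ` S)"] by simp
  finally show ?case .
qed simp

text \<open>The set \<open>V\<close> varies in the induction: a new member \<open>A\<close> removes from the complement in \<open>V\<close> the
complement in \<open>V \<inter> A\<close>.\<close>

lemma inclusion_exclusion_complement:
  assumes "finite \<A>" "finite V"
  shows "(\<Sum>\<B>\<in>Pow \<A>. (-1) ^ card \<B> * int (card (V \<inter> \<Inter>\<B>))) = int (card (V - \<Union>\<A>))"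
  using assms
proof (induct \<A> arbitrary: V rule: finite_induct)
  case (insert A \<A>)
  have "(\<Sum>\<B>\<in>Pow (insert A \<A>). (-1) ^ card \<B> * int (card (V \<inter> \<Inter>\<B>))) =
      (\<Sum>\<B>\<in>Pow \<A>. (-1) ^ card \<B> * (int (card (V \<inter> \<Inter>\<B>)) - int (card (V \<inter> \<Inter>(insert A \<B>)))))"
    by (rule alternating_sum_insert[OF insert.hyps(1)])
  also have "\<dots> = (\<Sum>\<B>\<in>Pow \<A>. (-1) ^ card \<B> * int (card (V \<inter> \<Inter>\<B>))) -
      (\<Sum>\<B>\<in>Pow \<A>. (-1) ^ card \<B> * int (card (V \<inter> A \<inter> \<Inter>\<B>)))"
    by (simp add: right_diff_distrib sum_subtractf Int_assoc)
  also have "\<dots> = int (card (V - \<Union>\<A>)) - int (card (V \<inter> A - \<Union>\<A>))"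
    using insert.hyps(3)[of V] insert.hyps(3)[of "V \<inter> A"] insert.prems by simp
  also have "\<dots> = int (card ((V - \<Union>\<A>) - (V \<inter> A - \<Union>\<A>)))"
    using insert.prems card_Diff_subset[of "V \<inter> A - \<Union>\<A>" "V - \<Union>\<A>"]
      card_mono[of "V - \<Union>\<A>" "V \<inter> A - \<Union>\<A>"] by (simp add: Diff_mono of_nat_diff)
  also have "(V - \<Union>\<A>) - (V \<inter> A - \<Union>\<A>) = V - \<Union>(insert A \<A>)" by blast
  finally show ?case .
qed simp

lemma signed_monom: "monom ((-1) ^ n) d = (-1) ^ n * (monom 1 d :: int poly)"
  by (cases "even n") (simp_all add: minus_monom)

lemma char_poly_arr_eq:
  assumes "finite \<A>"
  shows "char_poly_arr V \<A> = (\<Sum>\<B>\<in>Pow \<A>. (-1) ^ card \<B> *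
    (if V \<inter> \<Inter>\<B> \<noteq> {} then monom 1 (affine_dim (V \<inter> \<Inter>\<B>)) else 0))"
proof -
  have "(\<Sum>\<B>\<in>Pow \<A>. (-1) ^ card \<B> *
      (if V \<inter> \<Inter>\<B> \<noteq> {} then monom 1 (affine_dim (V \<inter> \<Inter>\<B>)) else 0 :: int poly)) =
    (\<Sum>\<B>\<in>Pow \<A>. if V \<inter> \<Inter>\<B> \<noteq> {} then monom ((-1) ^ card \<B>) (affine_dim (V \<inter> \<Inter>\<B>)) else 0)"
    by (rule sum.cong) (simp_all add: signed_monom)
  also have "\<dots> = (\<Sum>\<B>\<in>{\<B> \<in> Pow \<A>. V \<inter> \<Inter>\<B> \<noteq> {}}.
      monom ((-1) ^ card \<B>) (affine_dim (V \<inter> \<Inter>\<B>)))"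
    using assms by (intro sum.inter_filter[symmetric]) simp
  finally show ?thesis by (simp add: char_poly_arr_def)
qed

section \<open>The flow arrangement\<close>

context fin_digraph
begin

abbreviation bdry_space :: "'b set \<Rightarrow> ('a \<Rightarrow> 'f::field) set" where
  "bdry_space T \<equiv> boundary_space (edge_subgraph G T)"

lemma flow_hyperplane_eq: "e \<in> arcs G \<Longrightarrow> flow_hyperplane G b e = {c \<in> flows G b. c e = 0}"
  by (auto simp: flow_hyperplane_def coord_hyperplane_def flows_def)

lemma flows_eq_zero_on:
  "S \<subseteq> arcs G \<Longrightarrow> flows (edge_subgraph G (arcs G - S)) b = {c \<in> flows G b. \<forall>e\<in>S. c e = 0}"
  by (subst flows_edge_subgraph) (auto simp: flows_def coord_space_def)

lemma flows_Int_hyperplanes: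
  assumes "S \<subseteq> arcs G"
  shows "flows G b \<inter> \<Inter>(flow_hyperplane G b ` S) = flows (edge_subgraph G (arcs G - S)) b"
  unfolding flows_eq_zero_on[OF assms] using assms
  by (auto simp: flow_hyperplane_eq subset_iff)

lemma bdry_space_iff:
  "S \<subseteq> arcs G \<Longrightarrow> b \<in> bdry_space (arcs G - S) \<longleftrightarrow> (\<exists>c \<in> flows G b. \<forall>e\<in>S. c e = 0)"
  unfolding boundary_space_iff_flows by (auto simp: flows_eq_zero_on)

lemma E_cut_b_iff:
  "e \<in> E_cut_b G b \<longleftrightarrow> e \<in> E_cut G \<and> (\<exists>c \<in> flows G b. c e = 0)"
  using bdry_space_iff[of "{e}" b] E_cut_subset by (auto simp: E_cut_b_def del_edges_eq_edge_subgraph)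

lemma E_cut_b_flow_zero: "e \<in> E_cut_b G b \<Longrightarrow> c \<in> flows G b \<Longrightarrow> c e = 0"
  using E_cut_flow_eq by (metis E_cut_b_iff)

lemma E_cut_b_subset: "E_cut_b G b \<subseteq> E_cut G"
  by (auto simp: E_cut_b_def)

lemma flow_hyperplane_eq_flows_iff:
  fixes b :: "'a \<Rightarrow> 'f::field"
  assumes "b \<in> boundary_space G" "e \<in> arcs G"
  shows "flow_hyperplane G b e = flows G b \<longleftrightarrow> e \<in> E_cut_b G b"
proof
  assume "e \<in> E_cut_b G b"
  then show "flow_hyperplane G b e = flows G b"
    using assms(2) E_cut_b_flow_zero by (auto simp: flow_hyperplane_eq)
next
  assume eq: "flow_hyperplane G b e = flows G b"
  obtain c where c: "c \<in> flows G b" using assms(1) unfolding boundary_space_iff_flows by blast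
  have zero: "d e = 0" if "d \<in> flows G b" for d
    using that eq assms(2) by (auto simp: flow_hyperplane_eq)
  have "e \<notin> E_cyc G"
  proof
    assume "e \<in> E_cyc G"
    then obtain z :: "'b \<Rightarrow> 'f" where z: "z \<in> flows G 0" "z e = 1"
      using E_cyc_ex_circulation by blast
    then have "c + z \<in> flows G b"
      using c by (auto simp: flows_def coord_space_def boundary_linear)
    then show False using zero[OF c] zero[of "c + z"] z by simp
  qed
  then show "e \<in> E_cut_b G b"
    using assms(2) c zero[OF c] by (auto simp: E_cut_b_iff E_cut_def)
qed

text \<open>A flow supported on \<open>T\<close> vanishes on every cut-edge outside \<open>T\<close>, and such a cut-edge belongs to
\<open>E_cut_b G b\<close>.\<close>

lemma E_cut_subset_iff:
  assumes "T \<subseteq> arcs G" "b \<in> bdry_space T"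
  shows "E_cut_b G b \<subseteq> T \<longleftrightarrow> E_cut G \<subseteq> T"
proof
  assume sub: "E_cut_b G b \<subseteq> T"
  show "E_cut G \<subseteq> T"
  proof (rule ccontr)
    assume "\<not> E_cut G \<subseteq> T"
    then obtain e where e: "e \<in> E_cut G" "e \<notin> T" by blast
    have "arcs G - (arcs G - T) = T" using assms(1) by blast
    then obtain c where "c \<in> flows G b" "\<forall>f\<in>arcs G - T. c f = 0"
      using assms bdry_space_iff[of "arcs G - T" b] by auto
    then have "e \<in> E_cut_b G b" using e E_cut_subset by (auto simp: E_cut_b_iff)
    then show False using e sub by blast
  qed
qed (use E_cut_b_subset in blast)

text \<open>All flows with boundary \<open>b\<close> vanish on \<open>E_cut_b G b\<close>.\<close>

lemma bdry_space_Un_E_cut_b: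
  assumes "T \<subseteq> arcs G" "T \<inter> E_cut_b G b = {}"
  shows "b \<in> bdry_space (T \<union> E_cut_b G b) \<longleftrightarrow> b \<in> bdry_space T"
proof -
  let ?C = "E_cut_b G b"
  have C: "?C \<subseteq> arcs G" using E_cut_b_subset E_cut_subset by blast
  have "T \<union> ?C = arcs G - (arcs G - T - ?C)" "T = arcs G - (arcs G - T)" using assms C by blast+
  then have "b \<in> bdry_space (T \<union> ?C) \<longleftrightarrow> (\<exists>c \<in> flows G b. \<forall>e\<in>arcs G - T - ?C. c e = 0)"
    and "b \<in> bdry_space T \<longleftrightarrow> (\<exists>c \<in> flows G b. \<forall>e\<in>arcs G - T. c e = 0)"
    using bdry_space_iff[of "arcs G - T - ?C" b] bdry_space_iff[of "arcs G - T" b] by auto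
  then show ?thesis using E_cut_b_flow_zero[of _ b] by blast
qed

text \<open>The common value of the polynomials in the theorem.\<close>

definition flow_sum :: "('a \<Rightarrow> 'f::field) \<Rightarrow> int poly" where
  "flow_sum b = (\<Sum>T | T \<subseteq> arcs G \<and> E_cut G \<subseteq> T \<and> b \<in> bdry_space T.
     monom ((-1) ^ card (arcs G - T)) (nullity G T))"

text \<open>The same sum indexed by the set \<open>S = E - T\<close> of deleted edges, as it arises from the arrangement and
from the assigning polynomial.\<close>

lemma flow_sum_eq_deletions:
  "flow_sum b = (\<Sum>S | S \<subseteq> arcs G - E_cut_b G b \<and> b \<in> bdry_space (arcs G - S).
     monom ((-1) ^ card S) (nullity G (arcs G - S)))"
  unfolding flow_sum_def
proof (rule sum.reindex_bij_witness[where i = "\<lambda>S. arcs G - S" and j = "\<lambda>T. arcs G - T"])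
  fix T assume T: "T \<in> {T. T \<subseteq> arcs G \<and> E_cut G \<subseteq> T \<and> b \<in> bdry_space T}"
  then show TT: "arcs G - (arcs G - T) = T" by blast
  show "arcs G - T \<in> {S. S \<subseteq> arcs G - E_cut_b G b \<and> b \<in> bdry_space (arcs G - S)}"
    using T TT E_cut_b_subset[of b] by auto
  show "monom ((-1) ^ card (arcs G - T)) (nullity G (arcs G - (arcs G - T))) =
    (monom ((-1) ^ card (arcs G - T)) (nullity G T) :: int poly)" by (simp add: TT)
next
  fix S assume S: "S \<in> {S. S \<subseteq> arcs G - E_cut_b G b \<and> b \<in> bdry_space (arcs G - S)}"
  then show "arcs G - (arcs G - S) = S" by blast
  have "E_cut_b G b \<subseteq> arcs G - S" using S E_cut_b_subset E_cut_subset by blast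
  then show "arcs G - S \<in> {T. T \<subseteq> arcs G \<and> E_cut G \<subseteq> T \<and> b \<in> bdry_space T}"
    using S E_cut_subset_iff[of "arcs G - S" b] by blast
qed

text \<open>The edges that index the hyperplane arrangement; different edges may give the same hyperplane.\<close>

definition proper_edges :: "('a \<Rightarrow> 'f::field) \<Rightarrow> 'b set" where
  "proper_edges b = {e \<in> arcs G. flow_hyperplane G b e \<noteq> {} \<and> flow_hyperplane G b e \<noteq> flows G b}"

lemma flow_arr_proper_eq: "flow_arr_proper G b = flow_hyperplane G b ` proper_edges b"
  by (auto simp: flow_arr_proper_def flow_arr_def proper_edges_def)

lemma proper_edges_subset: "proper_edges b \<subseteq> arcs G"
  by (auto simp: proper_edges_def)

lemma finite_proper_edges: "finite (proper_edges b)"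
  using proper_edges_subset finite_arcs by (rule finite_subset)

lemma proper_edges_subset_E_cut_b:
  "b \<in> boundary_space G \<Longrightarrow> proper_edges b \<subseteq> arcs G - E_cut_b G b"
  using flow_hyperplane_eq_flows_iff by (auto simp: proper_edges_def)

lemma char_poly_eq_flow_sum:
  fixes b :: "'a \<Rightarrow> 'f::field"
  assumes b: "b \<in> boundary_space G"
  shows "char_poly_arr (flows G b) (flow_arr_proper G b) = flow_sum b"
proof -
  let ?E = "proper_edges b" and ?C = "E_cut_b G b"
  define g :: "('b \<Rightarrow> 'f) set set \<Rightarrow> int poly" where "g \<B> = (if flows G b \<inter> \<Inter>\<B> \<noteq> {}
    then monom 1 (affine_dim (flows G b \<inter> \<Inter>\<B>)) else 0)" for \<B>
  define h :: "'b set \<Rightarrow> int poly" where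
    "h S = (if b \<in> bdry_space (arcs G - S) then monom 1 (nullity G (arcs G - S)) else 0)" for S
  have gh: "g (flow_hyperplane G b ` S) = h S" if "S \<subseteq> arcs G" for S
    unfolding g_def h_def flows_Int_hyperplanes[OF that] boundary_space_iff_flows
    by (simp add: affine_dim_flows)
  have "char_poly_arr (flows G b) (flow_arr_proper G b) =
      (\<Sum>\<B>\<in>Pow (flow_arr_proper G b). (-1) ^ card \<B> * g \<B>)"
    unfolding g_def by (rule char_poly_arr_eq) (simp add: flow_arr_proper_eq finite_proper_edges)
  also have "\<dots> = (\<Sum>S\<in>Pow ?E. (-1) ^ card S * g (flow_hyperplane G b ` S))"
    unfolding flow_arr_proper_eq by (rule alternating_sum_image[OF finite_proper_edges])
  also have "\<dots> = (\<Sum>S\<in>Pow ?E. (-1) ^ card S * h S)"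
    using proper_edges_subset[of b] by (intro sum.cong refl) (simp add: gh subset_trans)
  also have "\<dots> = (\<Sum>S\<in>Pow (arcs G - ?C). (-1) ^ card S * h S)"
  proof (rule sum.mono_neutral_left)
    show "finite (Pow (arcs G - ?C))" by simp
    show "Pow ?E \<subseteq> Pow (arcs G - ?C)" using proper_edges_subset_E_cut_b[OF b] by blast
    show "\<forall>S\<in>Pow (arcs G - ?C) - Pow ?E. (-1) ^ card S * h S = 0"
    proof
      fix S assume S: "S \<in> Pow (arcs G - ?C) - Pow ?E"
      then obtain e where e: "e \<in> S" "e \<in> arcs G" "e \<notin> ?C" "e \<notin> ?E" by blast
      then have "flow_hyperplane G b e = {}"
        using flow_hyperplane_eq_flows_iff[OF b e(2)] by (auto simp: proper_edges_def)
      then have "b \<notin> bdry_space (arcs G - S)"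
        using S e by (subst bdry_space_iff) (auto simp: flow_hyperplane_eq)
      then show "(-1) ^ card S * h S = 0" by (simp add: h_def)
    qed
  qed
  also have "\<dots> = (\<Sum>S\<in>Pow (arcs G - ?C). if b \<in> bdry_space (arcs G - S)
      then monom ((-1) ^ card S) (nullity G (arcs G - S)) else 0)"
    by (rule sum.cong) (simp_all add: h_def signed_monom)
  also have "\<dots> = (\<Sum>S\<in>{S \<in> Pow (arcs G - ?C). b \<in> bdry_space (arcs G - S)}.
      monom ((-1) ^ card S) (nullity G (arcs G - S)))"
    by (intro sum.inter_filter[symmetric]) simp
  finally show ?thesis unfolding flow_sum_eq_deletions by simp
qed

lemma flow_sum_monic:
  assumes b: "b \<in> boundary_space G"
  shows "degree (flow_sum b) = nullity G (arcs G) \<and> lead_coeff (flow_sum b) = 1"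
proof -
  let ?\<T> = "{T. T \<subseteq> arcs G \<and> E_cut G \<subseteq> T \<and> b \<in> bdry_space T}" and ?n = "nullity G (arcs G)"
  have fin: "finite ?\<T>" by (rule finite_subset[of _ "Pow (arcs G)"]) auto
  have mem: "arcs G \<in> ?\<T>" using b E_cut_subset by simp
  have "coeff (\<Sum>T\<in>?\<T> - {arcs G}. monom ((-1) ^ card (arcs G - T)) (nullity G T) :: int poly) k = 0"
    if "k \<ge> ?n" for k
    unfolding coeff_sum
  proof (intro sum.neutral ballI)
    fix T assume "T \<in> ?\<T> - {arcs G}"
    then have "nullity G T < ?n" by (intro nullity_less) auto
    then show "coeff (monom ((-1) ^ card (arcs G - T)) (nullity G T) :: int poly) k = 0"
      using that by simp
  qed
  then have less: "coeff (flow_sum b) k = (if k = ?n then 1 else 0)" if "k \<ge> ?n" for k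
    using that unfolding flow_sum_def sum.remove[OF fin mem] by simp
  then have "degree (flow_sum b) \<le> ?n" by (intro degree_le) simp
  moreover have "coeff (flow_sum b) ?n = 1" using less by simp
  moreover from this have "?n \<le> degree (flow_sum b)" by (intro le_degree) simp
  ultimately show ?thesis by simp
qed

lemma poly_flow_sum:
  fixes b :: "'a \<Rightarrow> 'f::field"
  assumes b: "b \<in> boundary_space G" and fin: "finite (UNIV :: 'f set)"
  shows "poly (flow_sum b) (int (card (UNIV :: 'f set))) =
    int (card (arr_complement (flows G b) (flow_arr_proper G b)))"
proof -
  let ?\<A> = "flow_arr_proper G b" and ?V = "flows G b" and ?q = "int (card (UNIV :: 'f set))"
  have finA: "finite ?\<A>" by (simp add: flow_arr_proper_eq finite_proper_edges)
  have finV: "finite ?V" using card_flows(1)[OF fin, of "arcs G" b] by (cases "?V = {}") auto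
  have "poly (flow_sum b) ?q = (\<Sum>\<B>\<in>Pow ?\<A>. (-1) ^ card \<B> *
      poly (if ?V \<inter> \<Inter>\<B> \<noteq> {} then monom 1 (affine_dim (?V \<inter> \<Inter>\<B>)) else 0) ?q)"
    unfolding char_poly_eq_flow_sum[OF b, symmetric] char_poly_arr_eq[OF finA] poly_sum by simp
  also have "\<dots> = (\<Sum>\<B>\<in>Pow ?\<A>. (-1) ^ card \<B> * int (card (?V \<inter> \<Inter>\<B>)))"
  proof (intro sum.cong refl arg_cong[of _ _ "(*) _"])
    fix \<B> assume "\<B> \<in> Pow ?\<A>"
    then obtain S where S: "S \<subseteq> proper_edges b" "\<B> = flow_hyperplane G b ` S"
      unfolding flow_arr_proper_eq by (meson PowD subset_imageE)
    then have "S \<subseteq> arcs G" using proper_edges_subset[of b] by blast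
    then show "poly (if ?V \<inter> \<Inter>\<B> \<noteq> {} then monom 1 (affine_dim (?V \<inter> \<Inter>\<B>)) else 0) ?q =
        int (card (?V \<inter> \<Inter>\<B>))"
      unfolding S(2) flows_Int_hyperplanes[OF \<open>S \<subseteq> arcs G\<close>]
      by (auto simp: affine_dim_flows card_flows[OF fin] poly_monom)
  qed
  also have "\<dots> = int (card (?V - \<Union>?\<A>))"
    by (rule inclusion_exclusion_complement[OF finA finV])
  finally show ?thesis by (simp add: arr_complement_def)
qed

lemma arr_complement_eq_nz_flows:
  assumes b: "b \<in> boundary_space G"
  shows "arr_complement (flows G b) (flow_arr_proper G b) = nz_flows (del_edges G (E_cut_b G b)) b"
proof -
  let ?C = "E_cut_b G b"
  have C: "?C \<subseteq> arcs G" using E_cut_b_subset E_cut_subset by blast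
  have flows_H: "flows (del_edges G ?C) b = flows G b"
    unfolding del_edges_eq_edge_subgraph flows_eq_zero_on[OF C] using E_cut_b_flow_zero by blast
  have "c \<in> \<Union>(flow_arr_proper G b) \<longleftrightarrow> (\<exists>e\<in>arcs G - ?C. c e = 0)" if c: "c \<in> flows G b" for c
  proof
    assume "c \<in> \<Union>(flow_arr_proper G b)"
    then show "\<exists>e\<in>arcs G - ?C. c e = 0"
      using proper_edges_subset_E_cut_b[OF b] unfolding flow_arr_proper_eq
      by (auto simp: flow_hyperplane_eq subset_iff)
  next
    assume "\<exists>e\<in>arcs G - ?C. c e = 0"
    then obtain e where e: "e \<in> arcs G" "e \<notin> ?C" "c \<in> flow_hyperplane G b e"
      using c by (auto simp: flow_hyperplane_eq)
    then have "e \<in> proper_edges b"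
      using flow_hyperplane_eq_flows_iff[OF b e(1)] by (auto simp: proper_edges_def)
    then show "c \<in> \<Union>(flow_arr_proper G b)" using e unfolding flow_arr_proper_eq by blast
  qed
  then show ?thesis
    unfolding arr_complement_def nz_flows_def flows_H
    by (auto simp: del_edges_def)
qed

end

section \<open>The assigning polynomial depends only on the assigning\<close>

lemma induce_induce: "X \<subseteq> W \<Longrightarrow> (K \<restriction> W) \<restriction> X = K \<restriction> X"
  by (auto simp: induce_subgraph_def)

lemma link_induce:
  assumes "(x, y) \<in> link K" "x \<in> X" "\<And>e. e \<in> arcs K \<Longrightarrow> tail K e \<in> X \<longleftrightarrow> head K e \<in> X"
  shows "(x, y) \<in> link (K \<restriction> X)"
proof -
  have "y \<in> X \<and> (x, y) \<in> link (K \<restriction> X)"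
    using assms(1)[unfolded link_def]
  proof (induct rule: rtrancl_on_induct)
    case base
    then show ?case using assms(2) by (auto intro: link_refl)
  next
    case (step y z)
    then obtain e where e: "e \<in> arcs K" "(y, z) = (tail K e, head K e) \<or> (y, z) = (head K e, tail K e)"
      by (auto simp: ends_rel_def)
    then have z: "z \<in> X" and "e \<in> arcs (K \<restriction> X)"
      using assms(3)[OF e(1)] step(5) by (auto simp: induce_subgraph_def)
    then have "(y, z) \<in> ends_rel (K \<restriction> X)"
      using e by (auto simp: ends_rel_def intro!: bexI[of _ e])
    then show ?case using step(5) z unfolding link_def by (auto intro: rtrancl_on_into_rtrancl_on)
  qed
  then show ?thesis ..
qed

lemma component_linked_induce:
  assumes "wf_digraph K" "X \<in> components K" "x \<in> X" "y \<in> X"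
  shows "(x, y) \<in> link (K \<restriction> X)"
  using component_linked[OF assms(2-4)] assms(3) component_closed[OF assms(1,2)]
  by (rule link_induce)

lemma component_subset: "C \<in> components K \<Longrightarrow> C \<subseteq> verts K"
  by (metis Union_components Union_upper)

context fin_digraph
begin

lemma wf_induce: "wf_digraph (G \<restriction> W)"
  by (auto simp: wf_digraph_def induce_subgraph_def)

lemma link_induce_mono: "(x, y) \<in> link (G \<restriction> W) \<Longrightarrow> W \<subseteq> W' \<Longrightarrow> (x, y) \<in> link (G \<restriction> W')"
  by (erule link_mono) (simp_all add: induce_subgraph_def Collect_mono_iff subset_iff)

lemma arc_link_induce:
  "e \<in> arcs G \<Longrightarrow> tail G e \<in> W \<Longrightarrow> head G e \<in> W \<Longrightarrow> (tail G e, head G e) \<in> link (G \<restriction> W)"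
  using link_arc[OF wf_induce, of e W] by (simp add: induce_subgraph_def)

text \<open>Deleting one component \<open>X\<close> of what remains of \<open>C\<close> after the deletion of the connected set \<open>U\<close> leaves
\<open>C\<close> connected: a path in \<open>C\<close> towards \<open>U\<close> that starts outside \<open>X\<close> can only enter \<open>X\<close> by way of \<open>U\<close>, and
it may be stopped there.\<close>

lemma remaining_component_linked:
  assumes C: "C \<in> components G" and U: "U \<subseteq> C" "u \<in> U"
    and conn: "\<And>x. x \<in> U \<Longrightarrow> (x, u) \<in> link (G \<restriction> U)"
    and X: "X \<in> components (G \<restriction> (C - U))"
    and y: "y \<in> C - X"
  shows "(y, u) \<in> link (G \<restriction> (verts G - X))"
proof -
  have CV: "C \<subseteq> verts G" using component_subset[OF C] .
  have XC: "X \<subseteq> C - U" using component_subset[OF X] by simp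
  have UX: "U \<subseteq> verts G - X" using XC U CV by blast
  have link_yu: "(y, u) \<in> link G" using component_linked[OF C, of y u] y U by blast
  have "y \<in> C - X \<longrightarrow> (y, u) \<in> link (G \<restriction> (verts G - X))"
    using link_yu[unfolded link_def]
  proof (induct rule: converse_rtrancl_on_induct)
    case base
    show ?case using conn[OF U(2)] link_induce_mono[OF _ UX] by blast
  next
    case (step y z)
    show ?case
    proof
      assume y: "y \<in> C - X"
      obtain e where e: "e \<in> arcs G" "(y, z) = (tail G e, head G e) \<or> (y, z) = (head G e, tail G e)"
        using step(1) by (auto simp: ends_rel_def)
      then have z: "z \<in> C" using component_closed[OF wf_digraph_axioms C e(1)] y by auto
      show "(y, u) \<in> link (G \<restriction> (verts G - X))"
      proof (cases "y \<in> U")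
        case True
        then show ?thesis using conn link_induce_mono[OF _ UX] by blast
      next
        case False
        have "z \<notin> X"
        proof
          assume zX: "z \<in> X"
          then have "e \<in> arcs (G \<restriction> (C - U))"
            using e y False XC by (auto simp: induce_subgraph_def)
          then have "y \<in> X"
            using component_closed[OF wf_induce X] zX e by (auto simp: induce_subgraph_def)
          then show False using y by blast
        qed
        then have "(z, u) \<in> link (G \<restriction> (verts G - X))" using step(5) z by blast
        moreover have "y \<in> verts G - X" "z \<in> verts G - X" using y z \<open>z \<notin> X\<close> CV by auto
        then have "(y, z) \<in> link (G \<restriction> (verts G - X))"
          using e(2)
        proof (elim disjE)
          assume "(y, z) = (head G e, tail G e)" "y \<in> verts G - X" "z \<in> verts G - X"
          then show ?thesis using link_sym[OF arc_link_induce[OF e(1), of "verts G - X"]] by simp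
        qed (use arc_link_induce[OF e(1), of "verts G - X"] in simp)
        ultimately show ?thesis by (rule link_trans[rotated])
      qed
    qed
  qed
  then show ?thesis using y by blast
qed

text \<open>The set \<open>X\<close> is connected, and its deletion replaces the component \<open>C\<close> by \<open>C - X\<close>, which is nonempty as
it contains \<open>U\<close> and connected by the previous lemma. So the number of components is unchanged.\<close>

lemma complement_component_in_Lambda:
  assumes C: "C \<in> components G" and U: "U \<subseteq> C" "u \<in> U"
    and conn: "\<And>x. x \<in> U \<Longrightarrow> (x, u) \<in> link (G \<restriction> U)"
    and X: "X \<in> components (G \<restriction> (C - U))"
  shows "X \<in> Lambda G"
proof -
  let ?W = "verts G - X"
  have CV: "C \<subseteq> verts G" using component_subset[OF C] .
  have XC: "X \<subseteq> C - U" using component_subset[OF X] by simp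
  have Xne: "X \<noteq> {}" by (rule components_nonempty[OF X])
  have "connected (G \<restriction> X)"
    unfolding connected_iff_link
    using Xne component_linked_induce[OF wf_induce X, unfolded induce_induce[OF XC]] by simp
  moreover have "components (G \<restriction> ?W) = insert (C - X) (components G - {C})"
  proof (rule components_eqI)
    have un: "\<Union>(components G) = verts G" by (rule Union_components)
    have dis: "D \<inter> C = {}" if "D \<in> components G - {C}" for D
      using components_disjoint[of D G C] that C by blast
    show "\<Union>(insert (C - X) (components G - {C})) = verts (G \<restriction> ?W)"
      using un C XC dis by auto
    show "{} \<notin> insert (C - X) (components G - {C})"
      using components_nonempty[of _ G] U XC by blast
    show "(x, y) \<in> link (G \<restriction> ?W)"
      if D: "D \<in> insert (C - X) (components G - {C})" and xy: "x \<in> D" "y \<in> D" for D x y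
    proof (cases "D = C - X")
      case True
      then have "(x, u) \<in> link (G \<restriction> ?W)" "(y, u) \<in> link (G \<restriction> ?W)"
        using remaining_component_linked[OF C U conn X] xy by simp_all
      then show ?thesis by (rule link_trans[OF _ link_sym])
    next
      case False
      then have D: "D \<in> components G" "D \<noteq> C" using D by auto
      then have "D \<subseteq> ?W" using dis[of D] XC component_subset[OF D(1)] by blast
      then show ?thesis
        using component_linked_induce[OF wf_digraph_axioms D(1) xy] link_induce_mono by blast
    qed
    show "tail (G \<restriction> ?W) e \<in> D \<longleftrightarrow> head (G \<restriction> ?W) e \<in> D"
      if D: "D \<in> insert (C - X) (components G - {C})" and e: "e \<in> arcs (G \<restriction> ?W)" for D e
    proof -
      have e: "e \<in> arcs G" "tail G e \<notin> X" "head G e \<notin> X"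
        using e by (simp_all add: induce_subgraph_def)
      have "D = C - X \<or> D \<in> components G" using D by blast
      then have "tail G e \<in> D \<longleftrightarrow> head G e \<in> D"
      proof
        assume "D = C - X"
        then show ?thesis using component_closed[OF wf_digraph_axioms C e(1)] e by simp
      next
        assume "D \<in> components G"
        then show ?thesis using component_closed[OF wf_digraph_axioms _ e(1)] by simp
      qed
      then show ?thesis by (simp add: induce_subgraph_def)
    qed
  qed
  moreover have "C - X \<notin> components G - {C}"
    using components_disjoint[of "C - X" G C] C U XC by blast
  moreover have "finite (components G)" by (rule finite_components) simp
  ultimately have "num_components (G \<restriction> ?W) = num_components G"
    using card_Suc_Diff1[of "components G" C] C by (simp add: num_components_def)
  then show ?thesis
    unfolding Lambda_def using \<open>connected (G \<restriction> X)\<close> Xne XC CV by blast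
qed

text \<open>Let \<open>U\<close> be a component of \<open>(V, T)\<close> inside the component \<open>C\<close> of \<open>G\<close>. Each component \<open>X\<close> of the
subgraph induced by \<open>C - U\<close> is left by no edge of \<open>T\<close>, so \<open>b\<close> sums to zero over \<open>X\<close>; since
\<open>X \<in> \<Lambda>\<close>, so does \<open>b'\<close>. As \<open>b'\<close> sums to zero over \<open>C\<close>, it sums to zero over \<open>U\<close>.\<close>

lemma b_compatible_cong:
  fixes b b' :: "'a \<Rightarrow> 'f::field"
  assumes b: "b \<in> boundary_space G" and b': "b' \<in> boundary_space G"
    and same: "assigning G b = assigning G b'"
    and T: "T \<subseteq> arcs G" and comp: "b_compatible b (edge_subgraph G T)"
  shows "b_compatible b' (edge_subgraph G T)"
  unfolding b_compatible_def
proof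
  let ?K = "edge_subgraph G T"
  fix U assume U: "U \<in> components ?K"
  have wfK: "wf_digraph ?K" by (rule wf_edge_subgraph[OF T])
  obtain u where u: "u \<in> U" using components_nonempty[OF U] by blast
  then have "u \<in> verts G" using component_subset[OF U] by auto
  then obtain C where C: "C \<in> components G" "u \<in> C" using Union_components[of G] by blast
  have UC: "U \<subseteq> C"
  proof
    fix x assume "x \<in> U"
    then have "(u, x) \<in> link G"
      using component_linked[OF U u] link_subset_mono[of u x T "arcs G"] T by simp
    then show "x \<in> C"
      by (rule link_closed[OF _ C(2) component_closed[OF wf_digraph_axioms C(1)]])
  qed
  have conn: "(x, u) \<in> link (G \<restriction> U)" if "x \<in> U" for x
    using component_linked_induce[OF wfK U that u]
    by (rule link_mono) (use T in \<open>auto simp: induce_subgraph_def\<close>)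
  have sum_C: "(\<Sum>v\<in>C. b' v) = 0"
    using b' C boundary_space_iff[of "arcs G" b'] by (auto simp: b_compatible_def)
  let ?L = "G \<restriction> (C - U)"
  have finC: "finite C" using component_subset[OF C(1)] finite_verts by (rule finite_subset)
  have sum_X: "(\<Sum>v\<in>X. b' v) = 0" if X: "X \<in> components ?L" for X
  proof -
    have XC: "X \<subseteq> C - U" using component_subset[OF X] by simp
    have "b \<in> boundary_space ?K"
      using b comp boundary_space_iff[of "arcs G" b] boundary_space_iff[OF T, of b] by simp
    then obtain c where c: "c \<in> coord_space T" "b = boundary G c"
      by (auto simp: boundary_space_edge_subgraph[OF T])
    have "(\<Sum>v\<in>X. b v) = 0"
      unfolding c(2)
    proof (rule sum_boundary_closed[OF _ c(1)])
      show "finite X" using XC finC by (meson finite_Diff finite_subset)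
      fix e assume e: "e \<in> T"
      have "tail G e \<in> C - U \<longleftrightarrow> head G e \<in> C - U"
        using component_closed[OF wf_digraph_axioms C(1), of e] component_closed[OF wfK U, of e] e T
        by auto
      moreover have "e \<in> arcs ?L" if "tail G e \<in> C - U" "head G e \<in> C - U"
        using that e T by (auto simp: induce_subgraph_def)
      ultimately show "tail G e \<in> X \<longleftrightarrow> head G e \<in> X"
        using component_closed[OF wf_induce X, of e] XC by (auto simp: induce_subgraph_def)
    qed
    moreover have "X \<in> Lambda G"
      by (rule complement_component_in_Lambda[OF C(1) UC u conn X])
    ultimately show ?thesis
      using fun_cong[OF same, of X] by (auto simp: assigning_def split: if_splits)
  qed
  have "\<forall>X\<in>components ?L. finite X"
    using component_subset[of _ ?L] finC by (auto intro: finite_subset)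
  then have "sum b' (\<Union>(components ?L)) = (\<Sum>X\<in>components ?L. \<Sum>v\<in>X. b' v)"
    using components_disjoint[of _ ?L] by (subst sum.Union_disjoint) simp_all
  then have "(\<Sum>v\<in>C - U. b' v) = (\<Sum>X\<in>components ?L. \<Sum>v\<in>X. b' v)"
    unfolding Union_components by simp
  then have "(\<Sum>v\<in>C - U. b' v) = 0" by (simp add: sum_X)
  then show "(\<Sum>v\<in>U. b' v) = 0"
    using sum_C sum.subset_diff[OF UC finC, of b'] by simp
qed

lemma assigning_poly_eq:
  fixes b :: "'a \<Rightarrow> 'f::field"
  assumes b: "b \<in> boundary_space G"
  shows "assigning_poly TYPE('f) G (assigning G b) =
    (\<Sum>S | S \<subseteq> arcs G \<and> b \<in> bdry_space (arcs G - S).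
       monom ((-1) ^ card S) (nullity G (arcs G - S)))"
proof -
  \<comment> \<open>The representative on which the definition rests; it induces the same assigning as \<open>b\<close>.\<close>
  define b' where "b' = (SOME b' :: 'a \<Rightarrow> 'f. b' \<in> boundary_space G \<and> assigning G b' = assigning G b)"
  have b': "b' \<in> boundary_space G" "assigning G b' = assigning G b"
    using someI[of "\<lambda>b' :: 'a \<Rightarrow> 'f. b' \<in> boundary_space G \<and> assigning G b' = assigning G b" b] b
    unfolding b'_def by blast+
  have "b_compatible b' (del_edges G S) \<longleftrightarrow> b \<in> bdry_space (arcs G - S)" if "S \<subseteq> arcs G" for S
  proof -
    have "b_compatible b' (del_edges G S) \<longleftrightarrow> b_compatible b (del_edges G S)"
      unfolding del_edges_eq_edge_subgraph
      using b_compatible_cong[OF b'(1) b b'(2)] b_compatible_cong[OF b b'(1) b'(2)[symmetric]]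
      by (rule iffI) simp_all
    also have "\<dots> \<longleftrightarrow> b \<in> bdry_space (arcs G - S)"
      using boundary_space_iff[of "arcs G - S" b] boundary_space_iff[of "arcs G" b] b
      by (simp add: del_edges_eq_edge_subgraph)
    finally show ?thesis .
  qed
  then show ?thesis
    unfolding assigning_poly_def b'_def[symmetric] Let_def
    by (intro sum.cong) auto
qed

end

section \<open>Comparison of the polynomials\<close>

context fin_digraph
begin

text \<open>If \<open>\<pi>(T) = \<pi>(R)\<close> for an edge set \<open>R\<close> that contains all cut-edges, the ends of each cut-edge are
connected in \<open>T\<close>, which is possible only through the cut-edge itself. So the partition of \<open>T\<close> decides
whether \<open>T\<close> contains all cut-edges.\<close>

lemma flow_poly_on_edge_partitions_b:
  fixes b :: "'a \<Rightarrow> 'f::field"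
  assumes b: "b \<in> boundary_space G"
  shows "flow_poly_on G (edge_partitions_b G b) = flow_sum b"
proof -
  have bV: "b \<in> coord_space (verts G)" using b boundary_space_iff[of "arcs G" b] by simp
  have "edge_partition G T \<in> edge_partitions_b G b \<longleftrightarrow> E_cut G \<subseteq> T \<and> b \<in> bdry_space T"
    if T: "T \<subseteq> arcs G" for T
  proof -
    have "E_cut G \<subseteq> T" if R: "edge_partition G T = edge_partition G R" "E_cut G \<subseteq> R" "R \<subseteq> arcs G" for R
    proof
      fix e assume e: "e \<in> E_cut G"
      have "link (edge_subgraph G T) = link (edge_subgraph G R)"
        by (rule link_eq_if_components_eq) (use R(1) in \<open>simp add: edge_partition_def\<close>)
      moreover have "(tail G e, head G e) \<in> link (edge_subgraph G R)"
        using link_arc[OF wf_edge_subgraph[OF R(3)], of e] e R(2) by auto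
      ultimately have lk: "(tail G e, head G e) \<in> link (edge_subgraph G T)" by simp
      show "e \<in> T"
      proof (rule ccontr)
        assume "e \<notin> T"
        then have "T \<subseteq> arcs G - {e}" using T by blast
        then show False using link_subset_mono[OF lk] e by (simp add: E_cut_iff)
      qed
    qed
    then have "edge_partition G T \<in> edge_partitions_cut G \<longleftrightarrow> E_cut G \<subseteq> T"
      unfolding edge_partitions_cut_def using T by blast
    moreover have "b \<in> partition_space G (edge_partition G T) \<longleftrightarrow> b \<in> bdry_space T"
      unfolding boundary_space_iff[OF T] partition_space_def edge_partition_def b_compatible_def
      by simp
    ultimately show ?thesis unfolding edge_partitions_b_def by simp
  qed
  then show ?thesis
    unfolding flow_poly_on_def flow_sum_def by (intro sum.cong) auto
qed

lemma nullity_edge_subgraph: "nullity (edge_subgraph G S) T = nullity G T"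
  by (simp add: nullity_def edge_rank_def)

text \<open>Putting the edges of \<open>E_cut_b G b\<close> back changes neither the nullity, as they are cut-edges, nor the
solvability of the boundary equation, as all flows vanish on them.\<close>

lemma assigning_poly_eq_flow_sum:
  fixes b :: "'a \<Rightarrow> 'f::field"
  assumes b: "b \<in> boundary_space G"
  defines "H \<equiv> del_edges G (E_cut_b G b)"
  shows "assigning_poly TYPE('f) H (assigning H b) = flow_sum b"
proof -
  let ?C = "E_cut_b G b"
  have C: "?C \<subseteq> arcs G" using E_cut_b_subset E_cut_subset by blast
  have H: "H = edge_subgraph G (arcs G - ?C)" unfolding H_def by (rule del_edges_eq_edge_subgraph)
  interpret H: fin_digraph H unfolding H by (rule fin_edge_subgraph) blast
  have transfer: "b \<in> boundary_space (edge_subgraph H (arcs H - S)) \<longleftrightarrow> b \<in> bdry_space (arcs G - S)"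
    "nullity H (arcs H - S) = nullity G (arcs G - S)"
    if "S \<subseteq> arcs G - ?C" for S
  proof -
    have eq: "arcs G - S = (arcs G - ?C - S) \<union> ?C" using that C by blast
    show "b \<in> boundary_space (edge_subgraph H (arcs H - S)) \<longleftrightarrow> b \<in> bdry_space (arcs G - S)"
      unfolding eq H by (subst bdry_space_Un_E_cut_b) auto
    show "nullity H (arcs H - S) = nullity G (arcs G - S)"
      unfolding eq H nullity_edge_subgraph
      using nullity_Un_cut[OF E_cut_b_subset[of b], of "arcs G - ?C - S"] by fastforce
  qed
  have arcs_H: "arcs H = arcs G - ?C" by (simp add: H)
  have "b \<in> boundary_space H"
    using transfer(1)[of "{}"] b by (simp add: H)
  then have "assigning_poly TYPE('f) H (assigning H b) =
    (\<Sum>S | S \<subseteq> arcs H \<and> b \<in> boundary_space (edge_subgraph H (arcs H - S)).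
       monom ((-1) ^ card S) (nullity H (arcs H - S)))"
    by (rule H.assigning_poly_eq)
  also have "\<dots> = flow_sum b"
    unfolding flow_sum_eq_deletions
    by (rule sum.cong) (use transfer arcs_H in auto)
  finally show ?thesis .
qed

text \<open>Every edge set carries the zero flow, and removing the cut-edges from an edge set preserves its
nullity.\<close>

lemma flow_sum_zero:
  "flow_sum (\<lambda>_. 0 :: 'f::field) = flow_poly (del_edges G (E_cut G))"
proof -
  let ?C = "E_cut G"
  have zero: "(\<lambda>_. 0) \<in> (bdry_space T :: ('a \<Rightarrow> 'f) set)" if "T \<subseteq> arcs G" for T
    by (simp add: boundary_space_iff[OF that] coord_space_def b_compatible_def)
  have "flow_sum (\<lambda>_. 0 :: 'f) = (\<Sum>S\<in>Pow (arcs G - ?C). monom ((-1) ^ card (arcs G - ?C - S)) (nullity G S))"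
    unfolding flow_sum_def
  proof (rule sum.reindex_bij_witness[where i = "\<lambda>S. S \<union> ?C" and j = "\<lambda>T. T - ?C"])
    fix T assume T: "T \<in> {T. T \<subseteq> arcs G \<and> ?C \<subseteq> T \<and> (\<lambda>_. 0 :: 'f) \<in> bdry_space T}"
    then have eq: "(T - ?C) \<union> ?C = T" "arcs G - ?C - (T - ?C) = arcs G - T" by blast+
    then show "(T - ?C) \<union> ?C = T" by simp
    show "T - ?C \<in> Pow (arcs G - ?C)" using T by blast
    show "monom ((-1) ^ card (arcs G - ?C - (T - ?C))) (nullity G (T - ?C)) =
      (monom ((-1) ^ card (arcs G - T)) (nullity G T) :: int poly)"
    proof -
      have "T - ?C \<subseteq> arcs G" using T by blast
      then show ?thesis using nullity_Un_cut[OF order_refl, of "T - ?C"] unfolding eq by simp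
    qed
  next
    fix S assume S: "S \<in> Pow (arcs G - ?C)"
    then show "(S \<union> ?C) - ?C = S" by blast
    show "S \<union> ?C \<in> {T. T \<subseteq> arcs G \<and> ?C \<subseteq> T \<and> (\<lambda>_. 0 :: 'f) \<in> bdry_space T}"
      using S zero[of "S \<union> ?C"] E_cut_subset by blast
  qed
  then show ?thesis
    unfolding flow_poly_def del_edges_eq_edge_subgraph
    by (simp add: nullity_edge_subgraph)
qed

end

theorem theorem2p2:
  fixes G :: "('v, 'e) pre_digraph" and b :: "'v \<Rightarrow> 'f::field" and q :: nat
  assumes "fin_digraph G"
    and "b \<in> boundary_space G"
  shows "let \<chi> = char_poly_arr (flows G b) (flow_arr_proper G b);
             M = arr_complement (flows G b) (flow_arr_proper G b);
             H = del_edges G (E_cut_b G b);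
             \<alpha> = assigning H b
         in (degree \<chi> = nullity G (arcs G) \<and> lead_coeff \<chi> = 1) \<and>
            (\<chi> = assigning_poly TYPE('f) H \<alpha> \<and>
             assigning_poly TYPE('f) H \<alpha> = flow_poly_on G (edge_partitions_b G b) \<and>
             flow_poly_on G (edge_partitions_b G (\<lambda>_. 0 :: 'f)) =
               flow_poly (del_edges G (E_cut G))) \<and>
            (finite (UNIV :: 'f set) \<and> card (UNIV :: 'f set) = q \<longrightarrow>
             poly \<chi> (int q) = int (card M) \<and>
             card M = card (nz_flows H b) \<and>
             int (card (nz_flows H b)) = poly (flow_poly_on G (edge_partitions_b G b)) (int q))"
proof -
  interpret fin_digraph G by (rule assms(1))
  note b = assms(2)
  have zero: "(\<lambda>_. 0 :: 'f) \<in> boundary_space G"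
    using boundary_space_iff[of "arcs G" "\<lambda>_. 0 :: 'f"]
    by (simp add: coord_space_def b_compatible_def)
  have count: "poly (flow_sum b) (int q) = int (card (nz_flows (del_edges G (E_cut_b G b)) b))"
    if "finite (UNIV :: 'f set)" "card (UNIV :: 'f set) = q"
    using poly_flow_sum[OF b that(1)] that(2) by (simp add: arr_complement_eq_nz_flows[OF b])
  show ?thesis
    unfolding Let_def char_poly_eq_flow_sum[OF b] assigning_poly_eq_flow_sum[OF b]
      flow_poly_on_edge_partitions_b[OF b] flow_poly_on_edge_partitions_b[OF zero]
      flow_sum_zero arr_complement_eq_nz_flows[OF b]
    using flow_sum_monic[OF b]
    by (intro conjI impI refl; (elim conjE)?) (simp_all only: count)
qed

end
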